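(* For each $r>0$ there is an (irregular) tiling of the hyperbolic plane such that (i) every tile can be covered by $O(3^{8r})$ disks of radius $r$ (with an absolute implied constant, independent of $r$ and of the tile), and (ii) each two points with distance at most $2r$ lie in the same tile or in two adjacent tiles.
   Context: The hyperbolic plane has curvature $-1$ and distances are hyperbolic. A tiling of the hyperbolic plane is a (locally finite) partition of the plane into bounded polygonal regions called tiles, i.e. the tiles cover the plane and have pairwise disjoint interiors; "irregular" means that the tiles need not be congruent, regular or convex. A tiling is regarded as an infinite plane graph whose vertices are the corners, whose edges are the sides and whose faces are the tiles. Two tiles are adjacent if they share an edge (sharing only a vertex is not sufficient). *)

theory Defs
  imports "HOL-Analysis.Analysis"
begin

text \<open>The hyperbolic plane of curvature -1 in the upper half-plane model. Since the hyperbolic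
  metric induces the Euclidean topology on this open subset of the complex plane, \<open>interior\<close> and
  \<open>inside\<close> below are those of the ambient type.\<close>

definition hplane :: "complex set" where
  "hplane = {z. Im z > 0}"

definition hdist :: "complex \<Rightarrow> complex \<Rightarrow> real" where
  "hdist z w = arcosh (1 + (cmod (z - w))\<^sup>2 / (2 * Im z * Im w))"

definition hdisk :: "complex \<Rightarrow> real \<Rightarrow> complex set" where
  "hdisk c r = {z \<in> hplane. hdist c z \<le> r}"

definition hsegment :: "complex \<Rightarrow> complex \<Rightarrow> complex set" where
  "hsegment a b = {z \<in> hplane. hdist a z + hdist z b = hdist a b}"

text \<open>An edge is represented by the set of its two end points; for \<open>e = {a, b}\<close> the following
  union is just \<open>hsegment a b\<close>, because \<open>hsegment a a = {a}\<close>.\<close>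

definition edge_arc :: "complex set \<Rightarrow> complex set" where
  "edge_arc e = (\<Union>a\<in>e. \<Union>b\<in>e. hsegment a b)"

definition plane_edges :: "complex set set \<Rightarrow> bool" where
  "plane_edges E \<longleftrightarrow> (\<forall>e\<in>E. \<forall>f\<in>E. e \<noteq> f \<longrightarrow> edge_arc e \<inter> edge_arc f \<subseteq> e \<inter> f)"

text \<open>A polygon is given by the cyclic list of its corners. It need not be convex, and a corner may
  have a straight angle: a corner of one tile in the middle of a geometric side of another tile
  is a vertex of the plane graph, and hence a corner of both tiles.\<close>

definition polygon_edges :: "complex list \<Rightarrow> complex set set" where
  "polygon_edges p = (\<lambda>i. {p ! i, p ! (Suc i mod length p)}) ` {..<length p}"

definition simple_polygon :: "complex list \<Rightarrow> bool" where
  "simple_polygon p \<longleftrightarrow>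
     3 \<le> length p \<and> distinct p \<and> set p \<subseteq> hplane \<and> plane_edges (polygon_edges p)"

definition polygon_boundary :: "complex list \<Rightarrow> complex set" where
  "polygon_boundary p = \<Union> (edge_arc ` polygon_edges p)"

definition polygon_region :: "complex list \<Rightarrow> complex set" where
  "polygon_region p = polygon_boundary p \<union> inside (polygon_boundary p)"

text \<open>Two lists describing the same region are never both in a tiling, since the interiors
  would not be disjoint; so distinct members are distinct tiles.\<close>

definition hyperbolic_tiling :: "complex list set \<Rightarrow> bool" where
  "hyperbolic_tiling T \<longleftrightarrow>
     (\<forall>p\<in>T. simple_polygon p) \<and>
     plane_edges (\<Union> (polygon_edges ` T)) \<and>
     \<Union> (polygon_region ` T) = hplane \<and>
     (\<forall>p\<in>T. \<forall>q\<in>T. p \<noteq> q \<longrightarrow> interior (polygon_region p) \<inter> interior (polygon_region q) = {}) \<and>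
     (\<forall>z\<in>hplane. \<exists>\<epsilon>>0. finite {p \<in> T. polygon_region p \<inter> hdisk z \<epsilon> \<noteq> {}})"

definition adjacent_tiles :: "complex list \<Rightarrow> complex list \<Rightarrow> bool" where
  "adjacent_tiles p q \<longleftrightarrow> p \<noteq> q \<and> polygon_edges p \<inter> polygon_edges q \<noteq> {}"

end

theory Submission
  imports Defs
begin

text \<open>
  The tiling is a brick wall along horocycles. In the upper half-plane, consider the heights
  \<open>h k = exp (4 r k)\<close> for all integers \<open>k\<close>, and join equally spaced points of the horocycle
  \<open>Im z = h k\<close> by geodesic chords. The resulting curve lies between the heights \<open>h k\<close> and
  \<open>exp r * h k\<close> if the spacing is small enough. Two consecutive curves bound a strip, and vertical
  geodesic sides at the real parts \<open>m * \<sigma> k\<close>, where \<open>m\<close> has the parity of \<open>k\<close>, cut the strip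
  \<open>k\<close> into bricks of Euclidean width \<open>2 * \<sigma> k\<close>.

  The half-widths have to follow the heights, but the sides of neighbouring strips must stay away
  from each other. Both are achieved by letting \<open>\<sigma> k\<close> run through a fixed number times powers of 3:
  then \<open>\<sigma> (k + 1)\<close> is an odd multiple of \<open>\<sigma> k\<close>, so the sides above the upper curve of strip \<open>k\<close>
  are at odd distance, in the unit \<open>\<sigma> k\<close>, from the sides below it. Hence two bricks of neighbouring
  strips that contain points with real parts less than \<open>\<sigma> k\<close> apart overlap in a whole interval of
  length \<open>\<sigma> k\<close> and share a chord (\<open>bricks_next_level\<close>); two such bricks of the same strip
  are equal or share a side (\<open>bricks_same_level\<close>).

  It remains to relate this to the distance. Consecutive horocycles are at
  distance \<open>4 * r\<close>, of which the curve over the lower one uses up at most \<open>r\<close>. So a strip is thicker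
  than \<open>2 * r\<close>, and points at distance at most \<open>2 * r\<close> are in the same or in neighbouring strips
  (\<open>near_points_level\<close>). If the lower strip is the strip \<open>k\<close>, then their real parts differ by
  less than \<open>2 * sinh r * exp (6 * r) * h k\<close> (\<open>near_points_Re\<close>), and this, up to a factor 3 for
  rounding to a power of 3, is the choice of \<open>\<sigma> k\<close>. A brick of the strip \<open>k\<close> then fits
  into a rectangle of width at most \<open>12 * sinh r * exp (6 * r) * h k\<close> that reaches from the height
  \<open>h k\<close> to \<open>exp (8 * r) * h k\<close>. A disk of radius \<open>r\<close> covers a box of logarithmic height \<open>r\<close> and of
  width \<open>2 * h k * sinh (r/2)\<close>, so that 8 rows of \<open>O (cosh (r/2) * exp (6 * r))\<close> disks suffice
  (\<open>brick_covered_by_disks\<close>), which is \<open>O (exp (8 * r))\<close> and hence \<open>O (3 powr (8 * r))\<close>, uniformly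
  also as \<open>r\<close> tends to 0.

  That the bricks are polygons with the expected regions has two ingredients. The map
  \<open>z \<mapsto> (Re z, (cmod z)\<^sup>2)\<close> takes geodesic segments to straight segments (\<open>hsegment_iff\<close>), which
  gives equations for chords and sides. And a brick is the region between two graphs over an
  interval, so each point outside it escapes to infinity along a vertical ray
  (\<open>inside_between_graphs\<close>).
\<close>

section \<open>Hyperbolic distance\<close>

lemma cosh_le_iff_abs:
  fixes x y :: real
  assumes "0 \<le> y"
  shows "cosh x \<le> cosh y \<longleftrightarrow> \<bar>x\<bar> \<le> y"
proof -
  have "cosh \<bar>x\<bar> = cosh x" by (simp add: abs_if)
  then show ?thesis using cosh_real_nonneg_le_iff[of "\<bar>x\<bar>" y] assms by simp
qed

lemma cosh_ln_divide:
  fixes x y :: real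
  assumes "0 < x" "0 < y"
  shows "cosh (ln (y / x)) = 1 + (x - y)\<^sup>2 / (2 * x * y)"
  using assms cosh_ln_real[of "y / x"] by (simp add: field_simps power2_eq_square)

lemma cosh_hdist:
  assumes "z \<in> hplane" "w \<in> hplane"
  shows "cosh (hdist z w) = 1 + (cmod (z - w))\<^sup>2 / (2 * Im z * Im w)"
  using assms unfolding hdist_def hplane_def by (intro cosh_arcosh_real) auto

lemma cosh_hdist_coords:
  assumes "z \<in> hplane" "w \<in> hplane"
  shows "cosh (hdist z w) = ((cmod z)\<^sup>2 + (cmod w)\<^sup>2 - 2 * Re z * Re w) / (2 * Im z * Im w)"
proof -
  have "(cmod (z - w))\<^sup>2 + 2 * Im z * Im w = (cmod z)\<^sup>2 + (cmod w)\<^sup>2 - 2 * Re z * Re w"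
    unfolding cmod_power2 by (simp add: power2_eq_square algebra_simps)
  moreover have "2 * Im z * Im w \<noteq> 0" using assms by (auto simp: hplane_def)
  ultimately show ?thesis unfolding cosh_hdist[OF assms]
    by (metis add.commute add_divide_distrib divide_self)
qed

lemma hdist_nonneg:
  assumes "z \<in> hplane" "w \<in> hplane"
  shows "0 \<le> hdist z w"
  using assms unfolding hdist_def hplane_def by (intro arcosh_nonneg_real) auto

lemma hdist_commute: "hdist z w = hdist w z"
  unfolding hdist_def by (simp add: norm_minus_commute mult.commute mult.left_commute)

lemma hdist_le_iff:
  assumes "z \<in> hplane" "w \<in> hplane" "0 \<le> d"
  shows "hdist z w \<le> d \<longleftrightarrow> 1 + (cmod (z - w))\<^sup>2 / (2 * Im z * Im w) \<le> cosh d"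
  using cosh_real_nonneg_le_iff[OF hdist_nonneg[OF assms(1,2)] assms(3)] cosh_hdist[OF assms(1,2)]
  by simp

lemma hdist_eq_0_iff:
  assumes "z \<in> hplane" "w \<in> hplane"
  shows "hdist z w = 0 \<longleftrightarrow> z = w"
proof
  assume "hdist z w = 0"
  then have "(cmod (z - w))\<^sup>2 / (2 * Im z * Im w) = 0"
    using cosh_hdist[OF assms] by simp
  then show "z = w" using assms by (auto simp: hplane_def)
qed (simp add: hdist_def)

text \<open>For fixed heights the distance is least for points on a common vertical line, where it is
  the logarithm of the quotient of the heights.\<close>

lemma hdist_le_imp_Im_le:
  assumes "z \<in> hplane" "w \<in> hplane" "hdist z w \<le> d"
  shows "Im w \<le> exp d * Im z"
proof -
  have pos: "Im z > 0" "Im w > 0" using assms by (auto simp: hplane_def)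
  have "0 \<le> d" using hdist_nonneg[OF assms(1,2)] assms(3) by linarith
  define u where "u = Im w / Im z"
  have u: "u > 0" using pos unfolding u_def by simp
  have "cosh (ln u) = 1 + (Im z - Im w)\<^sup>2 / (2 * Im z * Im w)"
    unfolding u_def using pos by (rule cosh_ln_divide)
  also have "\<dots> \<le> 1 + (cmod (z - w))\<^sup>2 / (2 * Im z * Im w)"
    using pos by (intro add_left_mono divide_right_mono) (simp_all add: cmod_power2)
  also have "\<dots> \<le> cosh d" using assms \<open>0 \<le> d\<close> by (simp add: hdist_le_iff)
  finally have "\<bar>ln u\<bar> \<le> d"
    using \<open>0 \<le> d\<close> by (simp add: cosh_le_iff_abs)
  then have "u \<le> exp d" using u by (metis abs_le_D1 exp_ln exp_le_cancel_iff)
  then show ?thesis using pos unfolding u_def by (simp add: field_simps)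
qed

lemma hdist_le_imp_Re_diff:
  assumes "z \<in> hplane" "w \<in> hplane" "hdist z w \<le> d"
  shows "(Re z - Re w)\<^sup>2 \<le> 2 * Im z * Im w * (cosh d - 1)"
proof -
  have pos: "0 < 2 * Im z * Im w" using assms by (auto simp: hplane_def)
  have "0 \<le> d" using hdist_nonneg[OF assms(1,2)] assms(3) by linarith
  then have "(cmod (z - w))\<^sup>2 / (2 * Im z * Im w) \<le> cosh d - 1"
    using hdist_le_iff[OF assms(1,2)] assms(3) by simp
  then have "(cmod (z - w))\<^sup>2 \<le> (cosh d - 1) * (2 * Im z * Im w)"
    using pos by (simp only: pos_divide_le_eq)
  moreover have "(Re z - Re w)\<^sup>2 \<le> (cmod (z - w))\<^sup>2" by (simp add: cmod_power2)
  ultimately show ?thesis by (simp add: mult.commute)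
qed

section \<open>Geodesic segments\<close>

text \<open>In the hyperboloid model, a point \<open>z\<close> is represented by the vector
  \<open>Z = (1, Re z, (cmod z)\<^sup>2) / Im z\<close>, and \<open>cosh (hdist z w)\<close> is the Lorentzian inner product of \<open>Z\<close>
  and \<open>W\<close>. The hypotheses say that \<open>Z = \<alpha> * A + \<beta> * B\<close>; the conclusions follow by expanding the
  inner products of \<open>Z\<close> with \<open>A\<close>, \<open>B\<close> and itself. They will be read as
  \<open>sinh (hdist a z) = \<bar>\<beta>\<bar> * sinh (hdist a b)\<close>, the same for \<open>b\<close> with \<open>\<bar>\<alpha>\<bar>\<close>, and the addition
  formula for \<open>cosh\<close> up to the sign of \<open>\<alpha> * \<beta>\<close>.\<close>

lemma hdist_collinear:
  fixes t :: real
  assumes H: "a \<in> hplane" "b \<in> hplane" "z \<in> hplane"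
    and Re: "Re z = (1 - t) * Re a + t * Re b"
    and norm: "(cmod z)\<^sup>2 = (1 - t) * (cmod a)\<^sup>2 + t * (cmod b)\<^sup>2"
  defines "\<alpha> \<equiv> (1 - t) * Im a / Im z" and "\<beta> \<equiv> t * Im b / Im z"
  shows "(cosh (hdist a z))\<^sup>2 - 1 = \<beta>\<^sup>2 * ((cosh (hdist a b))\<^sup>2 - 1)"
    and "(cosh (hdist z b))\<^sup>2 - 1 = \<alpha>\<^sup>2 * ((cosh (hdist a b))\<^sup>2 - 1)"
    and "cosh (hdist a b) - cosh (hdist a z) * cosh (hdist z b)
         = \<alpha> * \<beta> * ((cosh (hdist a b))\<^sup>2 - 1)"
proof -
  define c1 c2 c3 where "c1 = cosh (hdist a z)" and "c2 = cosh (hdist z b)"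
    and "c3 = cosh (hdist a b)"
  have pos: "Im a > 0" "Im b > 0" "Im z > 0" using H by (auto simp: hplane_def)
  note c = cosh_hdist_coords[OF H(1) H(3)] cosh_hdist_coords[OF H(3) H(2)]
    cosh_hdist_coords[OF H(1) H(2)]
  have na: "(cmod a)\<^sup>2 = (Re a)\<^sup>2 + (Im a)\<^sup>2" and nb: "(cmod b)\<^sup>2 = (Re b)\<^sup>2 + (Im b)\<^sup>2"
    and nz: "(cmod z)\<^sup>2 = (Re z)\<^sup>2 + (Im z)\<^sup>2" by (simp_all add: cmod_power2)
  have p1: "2 * Im a * Im z * c1 = (cmod a)\<^sup>2 + (cmod z)\<^sup>2 - 2 * Re a * Re z"
    and p2: "2 * Im z * Im b * c2 = (cmod z)\<^sup>2 + (cmod b)\<^sup>2 - 2 * Re z * Re b"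
    and p3: "2 * Im a * Im b * c3 = (cmod a)\<^sup>2 + (cmod b)\<^sup>2 - 2 * Re a * Re b"
    unfolding c1_def c2_def c3_def c using pos by auto
  have "2 * Im a * (Im z * c1) = 2 * Im a * ((1 - t) * Im a + t * Im b * c3)"
    using p1 p3 Re norm na by algebra
  then have i1: "Im z * c1 = (1 - t) * Im a + t * Im b * c3" using pos by simp
  have "2 * Im b * (Im z * c2) = 2 * Im b * ((1 - t) * Im a * c3 + t * Im b)"
    using p2 p3 Re norm nb by algebra
  then have i2: "Im z * c2 = (1 - t) * Im a * c3 + t * Im b" using pos by simp
  have i3: "(1 - t) * Im a * (Im z * c1) + t * Im b * (Im z * c2) = Im z * Im z"
    using p1 p2 Re norm nz by algebra
  have e1: "c1 = \<alpha> + \<beta> * c3" and e2: "c2 = \<alpha> * c3 + \<beta>"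
    using i1 i2 pos unfolding \<alpha>_def \<beta>_def by (auto simp: field_simps)
  have e3: "\<alpha> * c1 + \<beta> * c2 = 1"
  proof -
    have "\<alpha> * c1 + \<beta> * c2
        = ((1 - t) * Im a * (Im z * c1) + t * Im b * (Im z * c2)) / (Im z * Im z)"
      using pos unfolding \<alpha>_def \<beta>_def add_divide_distrib by simp
    then show ?thesis unfolding i3 using pos by simp
  qed
  have "c1\<^sup>2 - 1 = \<beta>\<^sup>2 * (c3\<^sup>2 - 1)" "c2\<^sup>2 - 1 = \<alpha>\<^sup>2 * (c3\<^sup>2 - 1)"
    "c3 - c1 * c2 = \<alpha> * \<beta> * (c3\<^sup>2 - 1)"
    using e1 e2 e3 by algebra+
  then show "(cosh (hdist a z))\<^sup>2 - 1 = \<beta>\<^sup>2 * ((cosh (hdist a b))\<^sup>2 - 1)"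
    and "(cosh (hdist z b))\<^sup>2 - 1 = \<alpha>\<^sup>2 * ((cosh (hdist a b))\<^sup>2 - 1)"
    and "cosh (hdist a b) - cosh (hdist a z) * cosh (hdist z b)
         = \<alpha> * \<beta> * ((cosh (hdist a b))\<^sup>2 - 1)"
    unfolding c1_def c2_def c3_def .
qed

text \<open>A geodesic is an intersection of the hyperboloid with a plane, so its points have collinear
  images \<open>(Re z, (cmod z)\<^sup>2)\<close>: this is the Klein model with a parabola in place of the circle.
  For the direction from left to right, equality in the triangle inequality makes the Gram
  determinant of the three vectors vanish, which gives collinearity; the sign of
  \<open>cosh d3 - cosh d1 * cosh d2 = sinh d1 * sinh d2\<close> then puts \<open>z\<close> between \<open>a\<close> and \<open>b\<close>.\<close>

lemma hsegment_iff:
  assumes H: "a \<in> hplane" "b \<in> hplane" "z \<in> hplane" and "a \<noteq> b"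
  shows "z \<in> hsegment a b \<longleftrightarrow>
    (\<exists>t. 0 \<le> t \<and> t \<le> 1 \<and> Re z = (1 - t) * Re a + t * Re b \<and>
      (cmod z)\<^sup>2 = (1 - t) * (cmod a)\<^sup>2 + t * (cmod b)\<^sup>2)" (is "_ \<longleftrightarrow> ?R")
proof -
  define d1 d2 d3 where d: "d1 = hdist a z" "d2 = hdist z b" "d3 = hdist a b"
  have pos: "Im a > 0" "Im b > 0" "Im z > 0" using H by (auto simp: hplane_def)
  have nn: "0 \<le> d1" "0 \<le> d2" "0 < d3"
    using hdist_nonneg H hdist_eq_0_iff[OF H(1,2)] \<open>a \<noteq> b\<close> unfolding d by (auto simp: less_le)
  have sinh3: "(cosh d3)\<^sup>2 - 1 > 0" using nn by (simp add: cosh_square_eq)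
  note coll = hdist_collinear[OF H, folded d]
  show ?thesis
  proof
    assume ?R
    then obtain t where t: "0 \<le> t" "t \<le> 1" "Re z = (1 - t) * Re a + t * Re b"
      "(cmod z)\<^sup>2 = (1 - t) * (cmod a)\<^sup>2 + t * (cmod b)\<^sup>2" by blast
    define \<alpha> \<beta> where "\<alpha> = (1 - t) * Im a / Im z" and "\<beta> = t * Im b / Im z"
    have ab: "0 \<le> \<alpha>" "0 \<le> \<beta>" using t pos unfolding \<alpha>_def \<beta>_def by auto
    note k = coll[OF t(3,4), folded \<alpha>_def \<beta>_def, unfolded cosh_square_eq add_diff_cancel_right']
    have "sinh d1 = \<beta> * sinh d3"
      using k(1) ab nn by (simp add: power_mult_distrib[symmetric])
    moreover have "sinh d2 = \<alpha> * sinh d3"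
      using k(2) ab nn by (simp add: power_mult_distrib[symmetric])
    ultimately have "cosh (d1 + d2) = cosh d3"
      using k(3) unfolding cosh_add by (simp add: algebra_simps power2_eq_square)
    then have "d1 + d2 = d3"
      using nn by (metis add_nonneg_nonneg cosh_real_nonneg_le_iff eq_iff less_imp_le)
    then show "z \<in> hsegment a b" using H unfolding hsegment_def d by simp
  next
    assume "z \<in> hsegment a b"
    then have "d1 + d2 = d3" unfolding hsegment_def d by simp
    then have c3: "cosh d3 - cosh d1 * cosh d2 = sinh d1 * sinh d2"
      using cosh_add[of d1 d2] by simp
    \<comment> \<open>the determinant whose vanishing expresses collinearity of the images\<close>
    define D where "D = (Re z - Re a) * ((cmod b)\<^sup>2 - (cmod a)\<^sup>2)
      - (Re b - Re a) * ((cmod z)\<^sup>2 - (cmod a)\<^sup>2)"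
    have D: "D = 0"
    proof -
      have na: "(cmod a)\<^sup>2 = (Re a)\<^sup>2 + (Im a)\<^sup>2" and nb: "(cmod b)\<^sup>2 = (Re b)\<^sup>2 + (Im b)\<^sup>2"
        and nz: "(cmod z)\<^sup>2 = (Re z)\<^sup>2 + (Im z)\<^sup>2" by (simp_all add: cmod_power2)
      note c = cosh_hdist_coords[OF H(1) H(3)] cosh_hdist_coords[OF H(3) H(2)]
        cosh_hdist_coords[OF H(1) H(2)]
      have p1: "2 * Im a * Im z * cosh d1 = (cmod a)\<^sup>2 + (cmod z)\<^sup>2 - 2 * Re a * Re z"
        and p2: "2 * Im z * Im b * cosh d2 = (cmod z)\<^sup>2 + (cmod b)\<^sup>2 - 2 * Re z * Re b"
        and p3: "2 * Im a * Im b * cosh d3 = (cmod a)\<^sup>2 + (cmod b)\<^sup>2 - 2 * Re a * Re b"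
        unfolding d c using pos by auto
      have gram: "D\<^sup>2 = 4 * (Im a * Im b * Im z)\<^sup>2 *
          (((cosh d1)\<^sup>2 - 1) * ((cosh d2)\<^sup>2 - 1) - (cosh d3 - cosh d1 * cosh d2)\<^sup>2)"
        using p1 p2 p3 na nb nz unfolding D_def by algebra
      have "((cosh d1)\<^sup>2 - 1) * ((cosh d2)\<^sup>2 - 1) - (cosh d3 - cosh d1 * cosh d2)\<^sup>2 = 0"
        unfolding c3 by (simp add: cosh_square_eq power_mult_distrib)
      then show ?thesis using gram by simp
    qed
    obtain t where t: "Re z = (1 - t) * Re a + t * Re b"
      "(cmod z)\<^sup>2 = (1 - t) * (cmod a)\<^sup>2 + t * (cmod b)\<^sup>2"
    proof (cases "Re a = Re b")
      case False
      define t where "t = (Re z - Re a) / (Re b - Re a)"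
      have t: "t * (Re b - Re a) = Re z - Re a" using False unfolding t_def by simp
      have "(Re b - Re a) * (cmod z)\<^sup>2
          = (Re b - Re a) * ((1 - t) * (cmod a)\<^sup>2 + t * (cmod b)\<^sup>2)"
        using t D unfolding D_def by algebra
      then have "(cmod z)\<^sup>2 = (1 - t) * (cmod a)\<^sup>2 + t * (cmod b)\<^sup>2"
        using False by (subst (asm) mult_left_cancel) auto
      moreover have "Re z = (1 - t) * Re a + t * Re b" using t by (simp add: algebra_simps)
      ultimately show ?thesis by (rule that[rotated])
    next
      case True
      have "(Im a)\<^sup>2 \<noteq> (Im b)\<^sup>2"
        using True \<open>a \<noteq> b\<close> pos by (simp add: complex_eq_iff)
      then have ne: "(cmod a)\<^sup>2 \<noteq> (cmod b)\<^sup>2" using True by (simp add: cmod_power2)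
      then have "Re z = Re a" using D True by (simp add: D_def)
      define t where "t = ((cmod z)\<^sup>2 - (cmod a)\<^sup>2) / ((cmod b)\<^sup>2 - (cmod a)\<^sup>2)"
      have "t * ((cmod b)\<^sup>2 - (cmod a)\<^sup>2) = (cmod z)\<^sup>2 - (cmod a)\<^sup>2"
        using ne unfolding t_def by simp
      then have "(cmod z)\<^sup>2 = (1 - t) * (cmod a)\<^sup>2 + t * (cmod b)\<^sup>2"
        by (simp add: algebra_simps)
      moreover have "Re z = (1 - t) * Re a + t * Re b"
        using \<open>Re z = Re a\<close> True by (simp add: algebra_simps)
      ultimately show ?thesis by (rule that[rotated])
    qed
    have "0 \<le> sinh d1 * sinh d2" using nn by simp
    also have "sinh d1 * sinh d2
        = ((1 - t) * t) * (Im a * Im b / (Im z * Im z) * ((cosh d3)\<^sup>2 - 1))"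
      using coll(3)[OF t] c3 by (simp add: mult_ac)
    finally have prod: "0 \<le> (1 - t) * t * (Im a * Im b / (Im z * Im z) * ((cosh d3)\<^sup>2 - 1))" .
    have "0 < Im a * Im b / (Im z * Im z) * ((cosh d3)\<^sup>2 - 1)" using pos sinh3 by simp
    then have "0 \<le> (1 - t) * t"
      using prod zero_le_mult_iff[of "(1 - t) * t"] by (meson not_le)
    then have "0 \<le> t \<and> t \<le> 1" by (auto simp: zero_le_mult_iff)
    then show ?R using t by blast
  qed
qed

lemma hsegment_vertical:
  assumes "0 < y1" "y1 < y2"
  shows "hsegment (Complex x y1) (Complex x y2) = {z. Re z = x \<and> y1 \<le> Im z \<and> Im z \<le> y2}"
proof -
  have "z \<in> hsegment (Complex x y1) (Complex x y2) \<longleftrightarrow> Re z = x \<and> y1 \<le> Im z \<and> Im z \<le> y2"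
    (is "?L = ?R") for z
  proof
    assume ?L
    then have z: "z \<in> hplane" by (simp add: hsegment_def)
    obtain t where t: "0 \<le> t" "t \<le> 1" "Re z = (1 - t) * x + t * x"
      "(cmod z)\<^sup>2 = (1 - t) * (x\<^sup>2 + y1\<^sup>2) + t * (x\<^sup>2 + y2\<^sup>2)"
      using \<open>?L\<close> hsegment_iff[of "Complex x y1" "Complex x y2" z] assms z
      by (auto simp: hplane_def cmod_power2)
    have R: "Re z = x" using t(3) by (simp add: algebra_simps)
    have I: "(Im z)\<^sup>2 = y1\<^sup>2 + t * (y2\<^sup>2 - y1\<^sup>2)" "(Im z)\<^sup>2 = y2\<^sup>2 - (1 - t) * (y2\<^sup>2 - y1\<^sup>2)"
      using t(4) R by (simp_all add: cmod_power2 algebra_simps)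
    have "y2\<^sup>2 - y1\<^sup>2 \<ge> 0" using assms by simp
    then have "y1\<^sup>2 \<le> (Im z)\<^sup>2" using I(1) t(1) by simp
    moreover have "(Im z)\<^sup>2 \<le> y2\<^sup>2" using I(2) t(2) \<open>y2\<^sup>2 - y1\<^sup>2 \<ge> 0\<close>
      by (metis diff_ge_0_iff_ge diff_le_eq le_add_same_cancel1 mult_nonneg_nonneg)
    ultimately show ?R using R z assms by (auto simp: hplane_def intro: power2_le_imp_le)
  next
    assume R: ?R
    then have z: "z \<in> hplane" using assms by (simp add: hplane_def)
    have y: "y1\<^sup>2 < y2\<^sup>2" "y1\<^sup>2 \<le> (Im z)\<^sup>2" "(Im z)\<^sup>2 \<le> y2\<^sup>2"
      using R assms by (simp_all add: power_strict_mono)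
    define t where "t = ((Im z)\<^sup>2 - y1\<^sup>2) / (y2\<^sup>2 - y1\<^sup>2)"
    have t: "0 \<le> t" "t \<le> 1" "t * (y2\<^sup>2 - y1\<^sup>2) = (Im z)\<^sup>2 - y1\<^sup>2"
      using y unfolding t_def by simp_all
    have "(cmod z)\<^sup>2 = (1 - t) * (x\<^sup>2 + y1\<^sup>2) + t * (x\<^sup>2 + y2\<^sup>2)"
      "Re z = (1 - t) * x + t * x"
      using R t(3) unfolding cmod_power2 by (simp_all add: algebra_simps)
    then show ?L
      by (subst hsegment_iff, use z assms in \<open>simp_all add: hplane_def\<close>)
        (rule exI[of _ t], use t in \<open>simp add: cmod_power2\<close>)
  qed
  then show ?thesis by blast
qed

text \<open>The chord of a horocycle \<open>Im z = y\<close> is the arc of a Euclidean circle centred on the real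
  axis; the formula is the power of the point \<open>Re z\<close> with respect to the interval.\<close>

lemma hsegment_level:
  assumes "x1 < x2" "0 < y"
  shows "hsegment (Complex x1 y) (Complex x2 y) =
    {z. x1 \<le> Re z \<and> Re z \<le> x2 \<and> Im z = sqrt (y\<^sup>2 + (Re z - x1) * (x2 - Re z))}"
proof -
  have "z \<in> hsegment (Complex x1 y) (Complex x2 y) \<longleftrightarrow>
      x1 \<le> Re z \<and> Re z \<le> x2 \<and> Im z = sqrt (y\<^sup>2 + (Re z - x1) * (x2 - Re z))"
    (is "?L = ?R") for z
  proof
    assume ?L
    then have z: "z \<in> hplane" by (simp add: hsegment_def)
    obtain t where t: "0 \<le> t" "t \<le> 1" "Re z = (1 - t) * x1 + t * x2"
      "(cmod z)\<^sup>2 = (1 - t) * (x1\<^sup>2 + y\<^sup>2) + t * (x2\<^sup>2 + y\<^sup>2)"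
      using \<open>?L\<close> hsegment_iff[of "Complex x1 y" "Complex x2 y" z] assms z
      by (auto simp: hplane_def cmod_power2)
    have "Re z - x1 = t * (x2 - x1)" "x2 - Re z = (1 - t) * (x2 - x1)"
      using t(3) by (simp_all add: algebra_simps)
    then have "0 \<le> Re z - x1" "0 \<le> x2 - Re z" using t(1,2) assms by simp_all
    moreover have "(Im z)\<^sup>2 = y\<^sup>2 + (Re z - x1) * (x2 - Re z)"
    proof -
      have "(Im z)\<^sup>2 = (cmod z)\<^sup>2 - (Re z)\<^sup>2" by (simp add: cmod_power2)
      then show ?thesis using t(3,4) by algebra
    qed
    moreover have "Im z > 0" using z by (simp add: hplane_def)
    ultimately show ?R by (metis diff_ge_0_iff_ge less_imp_le real_sqrt_unique)
  next
    assume R: ?R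
    have nn: "0 \<le> (Re z - x1) * (x2 - Re z)" using R by simp
    have "0 < y\<^sup>2 + (Re z - x1) * (x2 - Re z)" using nn assms by (simp add: add_pos_nonneg)
    then have z: "z \<in> hplane" using R by (simp add: hplane_def)
    have I: "(Im z)\<^sup>2 = y\<^sup>2 + (Re z - x1) * (x2 - Re z)"
      using R nn by (simp add: add_nonneg_nonneg)
    define t where "t = (Re z - x1) / (x2 - x1)"
    have "t * (x2 - x1) = Re z - x1" using assms unfolding t_def by simp
    then have "Re z = (1 - t) * x1 + t * x2" by (simp add: algebra_simps)
    moreover have "0 \<le> t" "t \<le> 1" using R assms unfolding t_def by simp_all
    ultimately have t: "0 \<le> t" "t \<le> 1" "Re z = (1 - t) * x1 + t * x2" by blast+
    have "(cmod z)\<^sup>2 = (1 - t) * (x1\<^sup>2 + y\<^sup>2) + t * (x2\<^sup>2 + y\<^sup>2)"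
      using I t(3) cmod_power2[of z] by algebra
    then show ?L
      by (subst hsegment_iff, use z assms in \<open>simp_all add: hplane_def\<close>)
        (rule exI[of _ t], use t in \<open>simp add: cmod_power2\<close>)
  qed
  then show ?thesis by blast
qed

lemma edge_arc_pair:
  assumes "a \<in> hplane" "b \<in> hplane"
  shows "edge_arc {a, b} = hsegment a b"
proof -
  have refl: "hdist u u = 0" if "u \<in> hplane" for u using that by (simp add: hdist_eq_0_iff)
  have self: "hsegment u u = {u}" if u: "u \<in> hplane" for u
  proof -
    have "z = u" if "z \<in> hsegment u u" for z
    proof -
      have "z \<in> hplane" "hdist u z = 0"
        using that refl[OF u] unfolding hsegment_def by (auto simp: hdist_commute[of z])
      then show ?thesis using hdist_eq_0_iff[OF u, of z] by simp
    qed
    moreover have "u \<in> hsegment u u" using u refl[OF u] unfolding hsegment_def by simp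
    ultimately show ?thesis by blast
  qed
  have "hsegment b a = hsegment a b"
    unfolding hsegment_def using hdist_commute by (auto simp: add.commute)
  moreover have "a \<in> hsegment a b" "b \<in> hsegment a b"
    using assms refl[OF assms(1)] refl[OF assms(2)] by (simp_all add: hsegment_def)
  ultimately show ?thesis unfolding edge_arc_def using self assms by auto
qed

section \<open>Disks covering a rectangle\<close>

text \<open>By \<open>cosh_hdist\<close>, the vertical and the horizontal displacement contribute separately to
  \<open>cosh (hdist c z) - 1 = (cmod (c - z))\<^sup>2 / (2 * Im c * Im z)\<close>: at most \<open>cosh (r/2) - 1\<close> and at
  most \<open>(sinh (r/2))\<^sup>2 / 2\<close>, out of the available \<open>cosh r - 1 = 2 * (sinh (r/2))\<^sup>2\<close>.\<close>

lemma box_subset_hdisk: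
  assumes "0 < r" "0 < Im c" "0 < Im z"
    and Im: "Im z \<le> exp (r/2) * Im c" "Im c \<le> exp (r/2) * Im z"
    and Re: "\<bar>Re z - Re c\<bar> \<le> exp (-r/2) * sinh (r/2) * Im c"
  shows "z \<in> hdisk c r"
proof -
  define s where "s = sinh (r/2)"
  have s: "0 < s" using assms unfolding s_def by simp
  have "exp (-r/2) * Im c \<le> exp (-r/2) * (exp (r/2) * Im z)" using Im(2) by simp
  also have "\<dots> = Im z" by (simp add: exp_minus)
  finally have "s * (exp (-r/2) * Im c) \<le> s * Im z" using s by simp
  then have dz: "\<bar>Re c - Re z\<bar> \<le> s * Im z" using Re unfolding s_def by (simp add: mult_ac)
  have "exp (-r/2) * (s * Im c) \<le> 1 * (s * Im c)"
    using assms s by (intro mult_right_mono) auto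
  then have dc: "\<bar>Re c - Re z\<bar> \<le> s * Im c" using Re unfolding s_def by (simp add: mult_ac)
  have "\<bar>Re c - Re z\<bar> * \<bar>Re c - Re z\<bar> \<le> (s * Im z) * (s * Im c)"
    using dz dc s assms by (intro mult_mono) auto
  then have "(Re c - Re z)\<^sup>2 \<le> s\<^sup>2 * (Im c * Im z)"
    by (simp add: power2_eq_square mult_ac)
  then have horizontal: "(Re c - Re z)\<^sup>2 / (2 * Im c * Im z) \<le> s\<^sup>2 / 2"
    using assms by (simp add: field_simps)
  define u where "u = Im z / Im c"
  have u: "0 < u" using assms unfolding u_def by simp
  have "u \<le> exp (r/2)" "inverse u \<le> exp (r/2)"
    using assms unfolding u_def by (simp_all add: field_simps)
  then have "ln u \<le> r/2" "- ln u \<le> r/2"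
    using u by (metis ln_exp ln_mono ln_inverse positive_imp_inverse_positive)+
  then have "cosh (ln u) \<le> cosh (r/2)"
    using assms by (simp add: cosh_le_iff_abs)
  moreover have "cosh (ln u) = 1 + (Im c - Im z)\<^sup>2 / (2 * Im c * Im z)"
    unfolding u_def by (rule cosh_ln_divide) (use assms in auto)
  ultimately have vertical: "1 + (Im c - Im z)\<^sup>2 / (2 * Im c * Im z) \<le> cosh (r/2)" by simp
  have ch: "1 \<le> cosh (r/2)" by (rule cosh_real_ge_1)
  have "cosh (r/2) \<le> cosh (r/2) * cosh (r/2)"
    using mult_left_mono[OF ch, of "cosh (r/2)"] ch by simp
  then have "cosh (r/2) + s\<^sup>2 / 2 \<le> 1 + 2 * s\<^sup>2"
    using cosh_square_eq[of "r/2"] zero_le_power2[of s] unfolding s_def power2_eq_square by linarith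
  also have "\<dots> = cosh r"
    using cosh_double[of "r/2"] cosh_square_eq[of "r/2"] unfolding s_def by simp
  finally have "1 + (cmod (c - z))\<^sup>2 / (2 * Im c * Im z) \<le> cosh r"
    using horizontal vertical by (simp add: cmod_power2 add_divide_distrib)
  then show ?thesis using assms hdist_le_iff[of c z r] unfolding hdisk_def hplane_def by simp
qed

text \<open>Cut the rectangle into \<open>n\<close> rows whose upper and lower height have the quotient \<open>exp r\<close>, and
  each row into boxes of the width that suits the lowest row.\<close>

lemma rectangle_cover:
  fixes n :: nat and r h a b :: real
  assumes "0 < r" "0 < h" "a \<le> b"
  obtains D where "finite D" "D \<subseteq> hplane"
    "real (card D) \<le> n * ((b - a) / (2 * h * sinh (r/2)) + 1)"
    "{z. a \<le> Re z \<and> Re z \<le> b \<and> h \<le> Im z \<and> Im z < h * exp (real n * r)} \<subseteq> (\<Union>c\<in>D. hdisk c r)"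
proof -
  define \<delta> where "\<delta> = h * sinh (r/2)"
  have \<delta>: "0 < \<delta>" using assms unfolding \<delta>_def by simp
  \<comment> \<open>the height is the geometric mean of the heights of the two ends of row \<open>i\<close>\<close>
  define centre where "centre i j = Complex (a + (2 * real j + 1) * \<delta>) (h * exp (r/2 + real i * r))"
    for i j :: nat
  define J where "J = nat \<lfloor>(b - a) / (2 * \<delta>)\<rfloor>"
  define D where "D = case_prod centre ` ({..<n} \<times> {..J})"
  have "card D \<le> card ({..<n} \<times> {..J})" unfolding D_def by (rule card_image_le) simp
  also have "\<dots> = n * (J + 1)" by (simp add: card_cartesian_product)
  finally have "real (card D) \<le> real (n * (J + 1))" by (simp only: of_nat_le_iff)
  also have "\<dots> = n * (real J + 1)" by (simp add: algebra_simps)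
  also have "\<dots> \<le> n * ((b - a) / (2 * \<delta>) + 1)"
    using assms \<delta> unfolding J_def by (intro mult_left_mono add_right_mono) simp_all
  finally have card: "real (card D) \<le> n * ((b - a) / (2 * h * sinh (r/2)) + 1)"
    unfolding \<delta>_def mult.assoc .
  have cover: "z \<in> (\<Union>c\<in>D. hdisk c r)"
    if z: "a \<le> Re z" "Re z \<le> b" "h \<le> Im z" "Im z < h * exp (real n * r)" for z
  proof -
    define v where "v = ln (Im z / h) / r"
    define u where "u = (Re z - a) / (2 * \<delta>)"
    define i j where "i = nat \<lfloor>v\<rfloor>" and "j = nat \<lfloor>u\<rfloor>"
    have q: "1 \<le> Im z / h" "Im z / h < exp (real n * r)" using z assms by (simp_all add: field_simps)
    have Imz: "Im z = h * exp (v * r)" using assms q by (simp add: v_def)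
    have "ln (Im z / h) < n * r"
      using q ln_less_cancel_iff[of "Im z / h" "exp (real n * r)"] by (simp del: ln_less_cancel_iff)
    then have v: "0 \<le> v" "v < n" using assms q by (simp_all add: v_def field_simps)
    have i: "real i \<le> v" "v < real i + 1" "i < n" using v unfolding i_def by linarith+
    have u: "0 \<le> u" "u \<le> (b - a) / (2 * \<delta>)"
      using z \<delta> unfolding u_def by (simp_all add: divide_right_mono)
    have j: "real j \<le> u" "u < real j + 1" "j \<le> J"
      using u floor_mono[OF u(2)] unfolding j_def J_def by linarith+
    have Rez: "Re z = a + 2 * \<delta> * u" using \<delta> unfolding u_def by simp
    have "z \<in> hdisk (centre i j) r"
    proof (rule box_subset_hdisk)
      show "0 < r" "0 < Im (centre i j)" "0 < Im z" using assms z by (auto simp: centre_def)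
      have "v * r \<le> r/2 + (r/2 + real i * r)"
        using mult_right_mono[of v "real i + 1" r] i assms by (simp add: algebra_simps)
      then show "Im z \<le> exp (r/2) * Im (centre i j)"
        using assms unfolding Imz centre_def by (simp add: exp_add[symmetric] mult.left_commute)
      have "r/2 + real i * r \<le> r/2 + v * r" using i assms by simp
      then show "Im (centre i j) \<le> exp (r/2) * Im z"
        using assms unfolding Imz centre_def by (simp add: exp_add[symmetric] mult.left_commute)
      have "\<bar>Re z - Re (centre i j)\<bar> = \<bar>\<delta> * (2 * (u - real j) - 1)\<bar>"
        unfolding Rez centre_def by (simp add: algebra_simps)
      also have "\<dots> = \<delta> * \<bar>2 * (u - real j) - 1\<bar>" using \<delta> by (simp add: abs_mult)
      also have "\<dots> \<le> \<delta> * 1" using j \<delta> by (intro mult_left_mono) auto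
      also have "\<dots> \<le> \<delta> * exp (real i * r)" using \<delta> assms by simp
      also have "exp (real i * r) = exp (-r/2) * exp (r/2 + real i * r)"
        by (simp add: exp_add[symmetric])
      also have "\<delta> * (exp (-r/2) * exp (r/2 + real i * r)) = exp (-r/2) * sinh (r/2) * Im (centre i j)"
        unfolding \<delta>_def centre_def by simp
      finally show "\<bar>Re z - Re (centre i j)\<bar> \<le> exp (-r/2) * sinh (r/2) * Im (centre i j)" .
    qed
    moreover have "centre i j \<in> D" unfolding D_def using i(3) j(3) by auto
    ultimately show ?thesis by blast
  qed
  show ?thesis
    by (rule that[of D])
      (use card cover assms in \<open>auto simp: D_def centre_def hplane_def\<close>)
qed

section \<open>Regions between two graphs\<close>

definition between_graphs :: "(real \<Rightarrow> real) \<Rightarrow> (real \<Rightarrow> real) \<Rightarrow> real \<Rightarrow> real \<Rightarrow> complex set" where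
  "between_graphs f g a b = {z. a \<le> Re z \<and> Re z \<le> b \<and> f (Re z) \<le> Im z \<and> Im z \<le> g (Re z)}"

definition strict_between_graphs :: "(real \<Rightarrow> real) \<Rightarrow> (real \<Rightarrow> real) \<Rightarrow> real \<Rightarrow> real \<Rightarrow> complex set" where
  "strict_between_graphs f g a b = {z. a < Re z \<and> Re z < b \<and> f (Re z) < Im z \<and> Im z < g (Re z)}"

lemma closed_between_graphs:
  assumes "continuous_on UNIV f" "continuous_on UNIV g"
  shows "closed (between_graphs f g a b)"
  unfolding between_graphs_def
  by (intro closed_Collect_conj closed_Collect_le continuous_intros
      continuous_on_compose2[OF assms(1)] continuous_on_compose2[OF assms(2)]) auto

lemma open_strict_between_graphs:
  assumes "continuous_on UNIV f" "continuous_on UNIV g"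
  shows "open (strict_between_graphs f g a b)"
  unfolding strict_between_graphs_def
  by (intro open_Collect_conj open_Collect_less continuous_intros
      continuous_on_compose2[OF assms(1)] continuous_on_compose2[OF assms(2)]) auto

lemma bounded_between_graphs:
  assumes "continuous_on UNIV f" "continuous_on UNIV g"
  shows "bounded (between_graphs f g a b)"
proof -
  have "compact (f ` {a..b} \<union> g ` {a..b})"
    by (intro compact_Un compact_continuous_image continuous_on_subset[OF assms(1)]
        continuous_on_subset[OF assms(2)]) auto
  then have "bounded (f ` {a..b} \<union> g ` {a..b})" by (rule compact_imp_bounded)
  then obtain M where "\<forall>y\<in>f ` {a..b} \<union> g ` {a..b}. norm y \<le> M" unfolding bounded_iff ..
  then have M: "\<bar>y\<bar> \<le> M" if "y \<in> f ` {a..b} \<union> g ` {a..b}" for y using that by auto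
  show ?thesis
  proof (rule boundedI)
    fix z assume z: "z \<in> between_graphs f g a b"
    then have "\<bar>f (Re z)\<bar> \<le> M" "\<bar>g (Re z)\<bar> \<le> M" by (auto simp: between_graphs_def intro!: M)
    then have "\<bar>Im z\<bar> \<le> M" "\<bar>Re z\<bar> \<le> \<bar>a\<bar> + \<bar>b\<bar>"
      using z by (auto simp: between_graphs_def)
    then show "norm z \<le> \<bar>a\<bar> + \<bar>b\<bar> + M" using cmod_le[of z] by linarith
  qed
qed

text \<open>A point on the boundary leaves the region by a small horizontal or vertical move.\<close>

lemma interior_between_graphs:
  "interior (between_graphs f g a b) \<subseteq> strict_between_graphs f g a b"
proof
  fix z assume "z \<in> interior (between_graphs f g a b)"
  then obtain e where e: "e > 0" "ball z e \<subseteq> between_graphs f g a b"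
    by (auto simp: mem_interior)
  have "z + of_real d \<in> between_graphs f g a b \<and> z + of_real d * \<i> \<in> between_graphs f g a b"
    if "\<bar>d\<bar> < e" for d :: real
    using e(2) that by (auto simp: dist_norm norm_mult)
  from this[of "e/2"] this[of "-e/2"] show "z \<in> strict_between_graphs f g a b"
    using e(1) by (auto simp: between_graphs_def strict_between_graphs_def)
qed

lemma unbounded_vertical_ray:
  assumes ray: "\<And>y. 0 \<le> y \<Longrightarrow> z + of_real (s * y) * \<i> \<in> S" and "s \<noteq> 0"
  shows "\<not> bounded (connected_component_set S z)"
proof
  assume "bounded (connected_component_set S z)"
  then obtain M where M: "\<And>w. w \<in> connected_component_set S z \<Longrightarrow> norm w \<le> M"
    by (auto simp: bounded_iff)
  let ?L = "(\<lambda>y. z + of_real (s * y) * \<i>) ` {0..}"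
  have "connected ?L"
    by (intro connected_continuous_image continuous_intros) simp
  moreover have "z \<in> ?L" by (rule image_eqI[of _ _ 0]) auto
  ultimately have L: "?L \<subseteq> connected_component_set S z"
    using ray by (intro connected_component_maximal) auto
  define y where "y = (norm z + \<bar>M\<bar> + 1) / \<bar>s\<bar>"
  have y: "0 \<le> y" "\<bar>s\<bar> * y = norm z + \<bar>M\<bar> + 1" using assms(2) unfolding y_def by simp_all
  have "norm (of_real (s * y) * \<i>) - norm z \<le> norm (z + of_real (s * y) * \<i>)"
    using norm_triangle_ineq2[of "of_real (s * y) * \<i>" "- z"] by (simp add: add.commute)
  moreover have "norm (z + of_real (s * y) * \<i>) \<le> M" using L y(1) by (intro M) auto
  moreover have "norm (of_real (s * y) * \<i>) = norm z + \<bar>M\<bar> + 1"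
    using y by (simp add: norm_mult abs_mult)
  ultimately show False by linarith
qed

text \<open>A component of the complement that meets the open region \<open>Q\<close> cannot leave \<open>R\<close>, because \<open>Q\<close>
  and \<open>- R\<close> are disjoint open sets. A point outside \<open>R\<close> lies on a vertical ray that avoids \<open>R\<close>,
  pointing down from below the lower graph and up otherwise.\<close>

lemma inside_between_graphs:
  fixes a b :: real
  assumes cont: "continuous_on UNIV f" "continuous_on UNIV g"
  defines "R \<equiv> between_graphs f g a b" and "Q \<equiv> strict_between_graphs f g a b"
  shows "inside (R - Q) = Q"
proof
  have QR: "Q \<subseteq> R" unfolding R_def Q_def between_graphs_def strict_between_graphs_def by auto
  show "Q \<subseteq> inside (R - Q)"
  proof
    fix z assume z: "z \<in> Q"
    let ?C = "connected_component_set (- (R - Q)) z"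
    have zC: "z \<in> ?C" using z by (simp add: connected_component_refl)
    have "?C \<subseteq> Q \<union> - R" using connected_component_subset[of "- (R - Q)" z] by blast
    moreover have "open (- R)" "open Q"
      using closed_between_graphs[OF cont] open_strict_between_graphs[OF cont]
      unfolding R_def Q_def by auto
    ultimately have "- R \<inter> ?C = {}"
      using connectedD[OF connected_connected_component, of Q "- R" "- (R - Q)" z] QR zC z by blast
    then have "?C \<subseteq> R" by blast
    then have "bounded ?C"
      using bounded_between_graphs[OF cont] bounded_subset unfolding R_def by blast
    then show "z \<in> inside (R - Q)" using z unfolding inside_def by simp
  qed
  show "inside (R - Q) \<subseteq> Q"
  proof
    fix z assume z: "z \<in> inside (R - Q)"
    show "z \<in> Q"
    proof (rule ccontr)
      assume "z \<notin> Q"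
      then have zR: "z \<notin> R" using z unfolding inside_def by blast
      define s :: real where "s = (if Im z < f (Re z) then -1 else 1)"
      have "z + of_real (s * y) * \<i> \<in> - (R - Q)" if "0 \<le> y" for y :: real
        using zR that unfolding R_def between_graphs_def s_def by auto
      moreover have "s \<noteq> 0" unfolding s_def by simp
      ultimately have "\<not> bounded (connected_component_set (- (R - Q)) z)"
        by (rule unbounded_vertical_ray[of z s])
      then show False using z unfolding inside_def by simp
    qed
  qed
qed

section \<open>Edges of polygons\<close>

text \<open>A polygon that follows one list of corners forwards and another one backwards, and is closed
  by two edges between the lists.\<close>

lemma polygon_edges_strip:
  "polygon_edges (map f [0..<Suc L] @ rev (map g [0..<Suc M])) =
     (\<lambda>i. {f i, f (Suc i)}) ` {..<L} \<union> (\<lambda>i. {g i, g (Suc i)}) ` {..<M} \<union> {{f L, g M}, {f 0, g 0}}"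
    (is "polygon_edges ?p = ?R")
proof -
  have len: "length ?p = L + M + 2" by simp
  have lo: "?p ! i = f i" if "i \<le> L" for i using that by (simp add: nth_append del: upt_Suc)
  have hi: "?p ! i = g (L + 1 + M - i)" if "L < i" "i < L + M + 2" for i
    using that by (simp add: nth_append rev_nth del: upt_Suc) (simp only: add.commute)
  have e1: "{?p ! i, ?p ! (Suc i mod length ?p)} = {f i, f (Suc i)}" if "i < L" for i
    unfolding len using lo[of i] lo[of "Suc i"] that by (simp del: upt_Suc)
  have e2: "{?p ! i, ?p ! (Suc i mod length ?p)} = {f L, g M}" if "i = L" for i
    unfolding len using lo[of L] hi[of "Suc L"] that by (simp del: upt_Suc)
  have e3: "{?p ! i, ?p ! (Suc i mod length ?p)} = {g (L + M - i), g (Suc (L + M - i))}"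
    if "L < i" "i < L + M + 1" for i
  proof -
    have "?p ! i = g (Suc (L + M - i))" using hi[of i] that by (simp add: Suc_diff_le del: upt_Suc)
    moreover have "?p ! (Suc i) = g (L + M - i)" using hi[of "Suc i"] that by (simp del: upt_Suc)
    ultimately show ?thesis unfolding len using that by (auto simp del: upt_Suc)
  qed
  have e4: "{?p ! i, ?p ! (Suc i mod length ?p)} = {f 0, g 0}" if "i = L + M + 1" for i
    unfolding len using lo[of 0] hi[of "L + M + 1"] that by (auto simp del: upt_Suc)
  show ?thesis
  proof
    show "polygon_edges ?p \<subseteq> ?R"
    proof
      fix e assume "e \<in> polygon_edges ?p"
      then obtain i where i: "i < L + M + 2" "e = {?p ! i, ?p ! (Suc i mod length ?p)}"
        unfolding polygon_edges_def len by blast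
      consider "i < L" | "i = L" | "L < i" "i < L + M + 1" | "i = L + M + 1" using i(1) by linarith
      then show "e \<in> ?R"
      proof cases
        case 1 then show ?thesis unfolding i(2) e1[OF 1] by blast
      next
        case 2 then show ?thesis unfolding i(2) e2[OF 2] by blast
      next
        case 3
        then have "L + M - i < M" by simp
        then show ?thesis unfolding i(2) e3[OF 3] by blast
      next
        case 4 then show ?thesis unfolding i(2) e4[OF 4] by blast
      qed
    qed
    have mem: "{?p ! i, ?p ! (Suc i mod length ?p)} \<in> polygon_edges ?p" if "i < L + M + 2" for i
      unfolding polygon_edges_def by (rule image_eqI[of _ _ i]) (use that in \<open>simp_all del: upt_Suc\<close>)
    have "{f i, f (Suc i)} \<in> polygon_edges ?p" if "i < L" for i
      using mem[of i] e1[of i] that by simp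
    moreover have "{f L, g M} \<in> polygon_edges ?p" using mem[of L] e2[of L] by simp
    moreover have "{f 0, g 0} \<in> polygon_edges ?p" using mem[of "L+M+1"] e4[of "L+M+1"] by simp
    moreover have "{g i, g (Suc i)} \<in> polygon_edges ?p" if "i < M" for i
      using mem[of "L + M - i"] e3[of "L + M - i"] that by (simp del: upt_Suc)
    ultimately show "?R \<subseteq> polygon_edges ?p" by blast
  qed
qed

lemma plane_edges_subset: "plane_edges F \<Longrightarrow> E \<subseteq> F \<Longrightarrow> plane_edges E"
  unfolding plane_edges_def by blast

section \<open>Chains of chords along horocycles\<close>

text \<open>The function \<open>frac t * (1 - frac t)\<close> vanishes at the integers and is a parabola of slope at
  most 1 between them. It describes the shape of a chain of chords.\<close>

lemma frac_bump_Lipschitz: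
  fixes s t :: real
  shows "\<bar>frac s * (1 - frac s) - frac t * (1 - frac t)\<bar> \<le> \<bar>s - t\<bar>"
proof -
  have wlog: "\<bar>frac s * (1 - frac s) - frac t * (1 - frac t)\<bar> \<le> t - s" if "s \<le> t" for s t :: real
  proof (cases "\<lfloor>s\<rfloor> = \<lfloor>t\<rfloor>")
    case True
    have "frac s * (1 - frac s) - frac t * (1 - frac t) = (frac t - frac s) * (frac s + frac t - 1)"
      by (simp add: algebra_simps)
    moreover have "frac t - frac s = t - s" using True by (simp add: frac_def)
    moreover have "\<bar>frac s + frac t - 1\<bar> \<le> 1"
      using frac_lt_1[of s] frac_lt_1[of t] frac_ge_0[of s] frac_ge_0[of t] by linarith
    ultimately show ?thesis using that by (simp add: abs_mult mult_left_le)
  next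
    case False
    then have "\<lfloor>s\<rfloor> + 1 \<le> \<lfloor>t\<rfloor>" using floor_mono[OF that] by linarith
    then have le: "1 - frac s + frac t \<le> t - s" unfolding frac_def by linarith
    have fs: "0 \<le> frac s" "0 \<le> 1 - frac s" and ft: "0 \<le> frac t" "0 \<le> 1 - frac t"
      using frac_lt_1[of s] frac_lt_1[of t] frac_ge_0[of s] frac_ge_0[of t] by linarith+
    have "frac s * (1 - frac s) \<le> 1 - frac s" "frac t * (1 - frac t) \<le> frac t"
      using fs ft by (simp_all add: mult_left_le mult_left_le_one_le)
    moreover have "0 \<le> frac s * (1 - frac s)" "0 \<le> frac t * (1 - frac t)" using fs ft by simp_all
    ultimately show ?thesis using le fs ft by linarith
  qed
  show ?thesis using wlog[of s t] wlog[of t s] by (cases "s \<le> t") (auto simp: abs_minus_commute)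
qed

lemma frac_bump_nonneg: "0 \<le> frac (t::real) * (1 - frac t)"
  using frac_ge_0[of t] frac_lt_1[of t] by simp

lemma continuous_on_frac_bump: "continuous_on UNIV (\<lambda>t::real. frac t * (1 - frac t))"
  unfolding continuous_on_iff dist_real_def
  using frac_bump_Lipschitz by (meson le_less_trans)

text \<open>Strip \<open>k\<close> lies above the horocycle of height \<open>h k\<close>; its bricks have half-width \<open>\<sigma> k\<close>, and \<open>N\<close>
  chords of its upper boundary make up one half-width. The bottom of a brick is subdivided as the
  top of the strip below requires, so a half-width of the strip \<open>k\<close> has \<open>N * c k\<close> chords at the
  bottom. Oddness of \<open>c k\<close> keeps the sides of neighbouring strips in staggered positions. The
  condition \<open>flat\<close> says that the curve over the horocycle \<open>h k\<close>, which rises highest in the middle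
  of its chords, stays below the next horocycle.\<close>

locale horocyclic_bricks =
  fixes h \<sigma> :: "int \<Rightarrow> real" and N :: nat and c :: "int \<Rightarrow> nat"
  assumes h_pos: "0 < h k"
    and \<sigma>_pos: "0 < \<sigma> k"
    and N_pos: "0 < N"
    and \<sigma>_step: "\<sigma> k = of_nat (c k) * \<sigma> (k - 1)"
    and odd_c: "odd (c k)"
    and flat: "(h k)\<^sup>2 + (\<sigma> (k - 1) / N)\<^sup>2 / 4 < (h (k + 1))\<^sup>2"
    and exhaust: "0 < y \<Longrightarrow> \<exists>k. h k \<le> y \<and> y < h (k + 1)"
begin

definition mesh :: "int \<Rightarrow> real" where "mesh k = \<sigma> (k - 1) / N"

definition node :: "int \<Rightarrow> int \<Rightarrow> complex" where
  "node k n = Complex (of_int n * mesh k) (h k)"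

definition chord :: "int \<Rightarrow> int \<Rightarrow> complex set" where
  "chord k n = {node k n, node k (n + 1)}"

definition side :: "int \<Rightarrow> int \<Rightarrow> complex set" where
  "side k m = {Complex (of_int m * \<sigma> k) (h k), Complex (of_int m * \<sigma> k) (h (k + 1))}"

text \<open>The height over \<open>x\<close> of the chain of chords through the nodes of level \<open>k\<close>.\<close>

definition curve :: "int \<Rightarrow> real \<Rightarrow> real" where
  "curve k x = sqrt ((h k)\<^sup>2 + (mesh k)\<^sup>2 * (frac (x / mesh k) * (1 - frac (x / mesh k))))"

text \<open>The sides of the brick have the real parts \<open>m * \<sigma> k\<close> and \<open>(m + 2) * \<sigma> k\<close>, and its corners
  include all nodes on its bottom and top.\<close>

definition brick :: "int \<Rightarrow> int \<Rightarrow> complex list" where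
  "brick k m =
     map (\<lambda>i. node k (int (N * c k) * m + int i)) [0..<Suc (2 * (N * c k))] @
     rev (map (\<lambda>i. node (k + 1) (int N * m + int i)) [0..<Suc (2 * N)])"

text \<open>The parity condition staggers the strips: within a strip, the sides are \<open>2 * \<sigma> k\<close> apart, and
  from one strip to the next they are shifted by an odd multiple of the lower half-width.\<close>

definition bricks :: "complex list set" where
  "bricks = {brick k m |k m. even (m - k)}"

lemma mesh_pos: "0 < mesh k"
  unfolding mesh_def using \<sigma>_pos N_pos by simp

lemma column_bottom: "of_int m * \<sigma> k = of_int (int (N * c k) * m) * mesh k"
  unfolding mesh_def using N_pos \<sigma>_step[of k] by simp

lemma column_top: "of_int m * \<sigma> k = of_int (int N * m) * mesh (k + 1)"
  unfolding mesh_def using N_pos by simp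

lemma h_less_Suc: "h k < h (k + 1)"
proof -
  have "(h k)\<^sup>2 < (h (k + 1))\<^sup>2"
    using flat[of k] zero_le_power2[of "\<sigma> (k - 1) / N"] by linarith
  then show ?thesis using h_pos[of "k + 1"] by (simp add: power2_less_imp_less)
qed

lemma h_less_iff: "h i < h j \<longleftrightarrow> i < j"
proof -
  have less: "h i < h j" if "i < j" for i j
    using that by (induction rule: int_gr_induct) (use h_less_Suc less_trans in blast)+
  show ?thesis using less[of i j] less[of j i] by (cases i j rule: linorder_cases) auto
qed

lemma h_le_iff: "h i \<le> h j \<longleftrightarrow> i \<le> j"
  using h_less_iff[of j i] by auto

lemma curve_node: "curve k (of_int n * mesh k) = h k"
  unfolding curve_def using mesh_pos[of k] h_pos[of k] by simp

lemma curve_cell: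
  assumes "of_int n * mesh k \<le> x" "x \<le> of_int (n + 1) * mesh k"
  shows "curve k x = sqrt ((h k)\<^sup>2 + (x - of_int n * mesh k) * (of_int (n + 1) * mesh k - x))"
proof (cases "x = of_int (n + 1) * mesh k")
  case True
  then show ?thesis using curve_node[of k "n + 1"] h_pos[of k] by simp
next
  case False
  define u where "u = x / mesh k"
  have x: "x = u * mesh k" using mesh_pos[of k] unfolding u_def by simp
  have "of_int n \<le> u" "u < of_int (n + 1)"
    using assms False mesh_pos[of k] unfolding u_def by (simp_all add: field_simps)
  then have "\<lfloor>u\<rfloor> = n" by (simp add: floor_unique)
  then have fr: "frac u = u - of_int n" by (simp add: frac_def)
  show ?thesis unfolding curve_def u_def[symmetric] fr unfolding x
    by (simp add: algebra_simps power2_eq_square)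
qed

lemma h_le_curve: "h k \<le> curve k x"
proof -
  have "(h k)\<^sup>2 \<le> (h k)\<^sup>2 + (mesh k)\<^sup>2 * (frac (x / mesh k) * (1 - frac (x / mesh k)))"
    using frac_bump_nonneg by simp
  then show ?thesis unfolding curve_def using h_pos[of k] by (simp add: real_le_rsqrt)
qed

lemma curve_sq_le: "(curve k x)\<^sup>2 \<le> (h k)\<^sup>2 + (mesh k)\<^sup>2 / 4"
proof -
  let ?u = "frac (x / mesh k)"
  have "(curve k x)\<^sup>2 = (h k)\<^sup>2 + (mesh k)\<^sup>2 * (?u * (1 - ?u))"
    unfolding curve_def using frac_bump_nonneg by simp
  moreover have "?u * (1 - ?u) \<le> 1 / 4"
    using zero_le_power2[of "?u - 1/2"] by (simp add: power2_eq_square algebra_simps)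
  then have "(mesh k)\<^sup>2 * (?u * (1 - ?u)) \<le> (mesh k)\<^sup>2 * (1 / 4)" by (rule mult_left_mono) simp
  ultimately show ?thesis by simp
qed

lemma curve_less: "curve k x < h (k + 1)"
  using curve_sq_le[of k x] flat[of k] h_pos[of "k + 1"] unfolding mesh_def[symmetric]
  by (intro power2_less_imp_less[of "curve k x"]) auto

lemma curve_pos: "0 < curve k x"
  using h_pos[of k] h_le_curve[of k x] by linarith

lemma curve_less_curve: "i < j \<Longrightarrow> curve i x < curve j x"
  using curve_less[of i x] h_le_curve[of j x] h_le_iff[of "i + 1" j] by linarith

lemma curve_le_curve: "i \<le> j \<Longrightarrow> curve i x \<le> curve j x"
  using curve_less_curve[of i j x] by (cases "i = j") auto

lemma curve_eq_iff: "curve i x = curve j x \<longleftrightarrow> i = j"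
  using curve_less_curve[of i j x] curve_less_curve[of j i x] by (cases i j rule: linorder_cases) auto

lemma continuous_on_curve: "continuous_on UNIV (curve k)"
proof -
  have "continuous_on UNIV (\<lambda>x. frac (x / mesh k) * (1 - frac (x / mesh k)))"
    using mesh_pos[of k]
    by (intro continuous_on_compose2[OF continuous_on_frac_bump] continuous_intros) auto
  then show ?thesis unfolding curve_def[abs_def]
    by (intro continuous_on_real_sqrt continuous_on_add continuous_on_mult_left continuous_on_const)
qed

lemma node_in_hplane: "node k n \<in> hplane"
  using h_pos by (simp add: node_def hplane_def)

lemma node_eqI: "Re z = of_int n * mesh k \<Longrightarrow> Im z = h k \<Longrightarrow> z = node k n"
  by (simp add: node_def complex_eq_iff)

lemma edge_arc_chord:
  "edge_arc (chord k n) =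
     {z. of_int n * mesh k \<le> Re z \<and> Re z \<le> of_int (n + 1) * mesh k \<and> Im z = curve k (Re z)}"
proof -
  have "of_int n * mesh k < of_int (n + 1) * mesh k" using mesh_pos[of k] by simp
  from hsegment_level[OF this h_pos[of k]] show ?thesis
    unfolding chord_def edge_arc_pair[OF node_in_hplane node_in_hplane] unfolding node_def
    using curve_cell by auto
qed

lemma edge_arc_side:
  "edge_arc (side k m) = {z. Re z = of_int m * \<sigma> k \<and> h k \<le> Im z \<and> Im z \<le> h (k + 1)}"
  unfolding side_def using hsegment_vertical[OF h_pos[of k] h_less_Suc[of k]] h_pos
  by (subst edge_arc_pair) (auto simp: hplane_def)

lemma Union_chords:
  assumes "p < q"
  shows "(\<Union>n\<in>{p..<q}. edge_arc (chord k n)) =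
    {z. of_int p * mesh k \<le> Re z \<and> Re z \<le> of_int q * mesh k \<and> Im z = curve k (Re z)}" (is "?L = ?R")
proof
  show "?L \<subseteq> ?R"
  proof
    fix z assume "z \<in> ?L"
    then obtain n where n: "p \<le> n" "n + 1 \<le> q" "z \<in> edge_arc (chord k n)" by auto
    have "of_int p * mesh k \<le> of_int n * mesh k" "of_int (n + 1) * mesh k \<le> of_int q * mesh k"
      using n(1,2) mesh_pos[of k] by (simp_all del: of_int_add)
    then show "z \<in> ?R" using n(3) unfolding edge_arc_chord by auto
  qed
  show "?R \<subseteq> ?L"
  proof
    fix z assume z: "z \<in> ?R"
    define u where "u = Re z / mesh k"
    \<comment> \<open>the minimum matters at the right end of the interval only\<close>
    define n where "n = min \<lfloor>u\<rfloor> (q - 1)"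
    have u: "of_int p \<le> u" "u \<le> of_int q" "Re z = u * mesh k"
      using z mesh_pos[of k] unfolding u_def by (simp_all add: field_simps)
    have "of_int n \<le> u" "u \<le> of_int (n + 1)" "p \<le> n" "n < q"
      using u(1,2) assms unfolding n_def by linarith+
    moreover from this have "of_int n * mesh k \<le> Re z" "Re z \<le> of_int (n + 1) * mesh k"
      unfolding u(3) using mesh_pos[of k] by (simp_all del: of_int_add)
    ultimately show "z \<in> ?L" using z unfolding edge_arc_chord by auto
  qed
qed

section \<open>Bricks as polygons\<close>

lemma polygon_edges_brick:
  "polygon_edges (brick k m) =
     chord k ` {int (N * c k) * m..<int (N * c k) * (m + 2)} \<union>
     chord (k + 1) ` {int N * m..<int N * (m + 2)} \<union> {side k m, side k (m + 2)}"
proof -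
  have chords: "(\<lambda>i. {node l (p + int i), node l (p + int (Suc i))}) ` {..<K} = chord l ` {p..<p + int K}"
    for l p K
  proof -
    have "{p..<p + int K} = (\<lambda>i. p + int i) ` {..<K}"
    proof safe
      fix n assume "n \<in> {p..<p + int K}"
      then show "n \<in> (\<lambda>i. p + int i) ` {..<K}" by (intro image_eqI[of _ _ "nat (n - p)"]) auto
    qed auto
    then show ?thesis unfolding chord_def by (simp add: image_image add.assoc add.commute[of 1])
  qed
  have end1: "{node k (p + int K), node (k + 1) (q + int M)} = side k (m + 2)"
    if "p + int K = int (N * c k) * (m + 2)" "q + int M = int N * (m + 2)" for p q K M
    unfolding that side_def node_def column_bottom[symmetric] column_top[symmetric] ..
  have end2: "{node k (int (N * c k) * m + int 0), node (k + 1) (int N * m + int 0)} = side k m"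
    unfolding side_def node_def of_nat_0 add_0_right column_bottom[symmetric] column_top[symmetric] ..
  have e: "int (N * c k) * m + int (2 * (N * c k)) = int (N * c k) * (m + 2)"
    "int N * m + int (2 * N) = int N * (m + 2)" by (simp_all add: algebra_simps)
  show ?thesis unfolding brick_def polygon_edges_strip chords end1[OF e] end2 unfolding e by blast
qed

abbreviation brick_region :: "int \<Rightarrow> int \<Rightarrow> complex set" where
  "brick_region k m \<equiv>
     between_graphs (curve k) (curve (k + 1)) (of_int m * \<sigma> k) (of_int (m + 2) * \<sigma> k)"

abbreviation brick_core :: "int \<Rightarrow> int \<Rightarrow> complex set" where
  "brick_core k m \<equiv>
     strict_between_graphs (curve k) (curve (k + 1)) (of_int m * \<sigma> k) (of_int (m + 2) * \<sigma> k)"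

lemma c_pos: "0 < c k"
  using odd_c[of k] by (cases "c k") auto

lemma curve_column:
  "curve k (of_int m * \<sigma> k) = h k" "curve (k + 1) (of_int m * \<sigma> k) = h (k + 1)"
  unfolding column_bottom curve_node by (rule refl)
    (metis column_bottom column_top curve_node)

lemma polygon_boundary_brick: "polygon_boundary (brick k m) = brick_region k m - brick_core k m"
proof -
  have "int (N * c k) * m < int (N * c k) * (m + 2)" "int N * m < int N * (m + 2)"
    using N_pos c_pos[of k] by (simp_all add: algebra_simps)
  note U = Union_chords[OF this(1), of k] Union_chords[OF this(2), of "k + 1"]
  have less: "curve k x < curve (k + 1) x" for x by (rule curve_less_curve) simp
  have "polygon_boundary (brick k m) =
      (\<Union>n\<in>{int (N * c k) * m..<int (N * c k) * (m + 2)}. edge_arc (chord k n)) \<union>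
      (\<Union>n\<in>{int N * m..<int N * (m + 2)}. edge_arc (chord (k + 1) n)) \<union>
      edge_arc (side k m) \<union> edge_arc (side k (m + 2))"
    unfolding polygon_boundary_def polygon_edges_brick by blast
  also have "\<dots> = brick_region k m - brick_core k m" (is "?L = ?R")
  proof (rule set_eqI)
    fix z
    have "of_int m * \<sigma> k \<le> of_int (m + 2) * \<sigma> k" using \<sigma>_pos[of k] by simp
    then show "z \<in> ?L \<longleftrightarrow> z \<in> ?R"
      unfolding U column_bottom[symmetric] column_top[symmetric] edge_arc_side between_graphs_def strict_between_graphs_def
      using less[of "Re z"] curve_column[of k m] curve_column[of k "m + 2"] by auto
  qed
  finally show ?thesis .
qed

lemma polygon_region_brick: "polygon_region (brick k m) = brick_region k m"
proof -
  have "brick_core k m \<subseteq> brick_region k m"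
    unfolding between_graphs_def strict_between_graphs_def by auto
  then show ?thesis
    unfolding polygon_region_def polygon_boundary_brick
      inside_between_graphs[OF continuous_on_curve continuous_on_curve] by blast
qed

section \<open>Planarity of the brick wall\<close>

text \<open>Over a multiple of the mesh, a chain of chords has a node; if this node is on a given chord, it
  is one of the ends.\<close>

lemma chord_over_mesh_point:
  assumes "z \<in> edge_arc (chord k n)" "Re z = of_int q * mesh k"
  shows "z \<in> chord k n"
proof -
  have "Im z = h k" using assms curve_node[of k q] unfolding edge_arc_chord by simp
  moreover have "of_int n * mesh k \<le> of_int q * mesh k" "of_int q * mesh k \<le> of_int (n + 1) * mesh k"
    using assms unfolding edge_arc_chord by auto
  then have "q = n \<or> q = n + 1" using mesh_pos[of k] by (auto simp del: of_int_add)
  ultimately show ?thesis using node_eqI[OF assms(2)] unfolding chord_def by auto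
qed

lemma chords_meet:
  assumes z: "z \<in> edge_arc (chord k n)" "z \<in> edge_arc (chord k' n')" and ne: "chord k n \<noteq> chord k' n'"
  shows "z \<in> chord k n \<and> z \<in> chord k' n'"
proof -
  have "curve k (Re z) = curve k' (Re z)" using z unfolding edge_arc_chord by auto
  then have k: "k' = k" by (simp add: curve_eq_iff)
  have "of_int n * mesh k \<le> of_int (n' + 1) * mesh k" "of_int n' * mesh k \<le> of_int (n + 1) * mesh k"
    using z unfolding k edge_arc_chord mem_Collect_eq by linarith+
  then have "n \<le> n' + 1" "n' \<le> n + 1" using mesh_pos[of k] by (simp_all del: of_int_add)
  moreover have "n \<noteq> n'" using ne k by auto
  ultimately consider "n = n' + 1" | "n' = n + 1" by linarith
  then have "Re z = of_int n * mesh k \<or> Re z = of_int n' * mesh k"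
    using z unfolding k edge_arc_chord by cases auto
  then show ?thesis using chord_over_mesh_point z unfolding k by blast
qed

lemma chord_side_meet:
  assumes z: "z \<in> edge_arc (chord k n)" "z \<in> edge_arc (side l m)"
  shows "z \<in> chord k n \<and> z \<in> side l m"
proof -
  have Re: "Re z = of_int m * \<sigma> l" and Im: "h l \<le> Im z" "Im z \<le> h (l + 1)"
    using z(2) unfolding edge_arc_side by auto
  have curve: "Im z = curve k (Re z)" using z(1) unfolding edge_arc_chord by auto
  have "h l < h (k + 1)" "h k \<le> h (l + 1)"
    using curve Im h_le_curve[of k "Re z"] curve_less[of k "Re z"] by linarith+
  then have "l < k + 1" "k \<le> l + 1" unfolding h_less_iff h_le_iff .
  then consider "k = l" | "k = l + 1" by linarith
  then show ?thesis
  proof cases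
    case 1
    have "Re z = of_int (int (N * c k) * m) * mesh k" using Re column_bottom 1 by metis
    then have "z \<in> chord k n" by (rule chord_over_mesh_point[OF z(1)])
    moreover have "Im z = h l" using curve Re curve_column(1)[of l m] 1 by simp
    ultimately show ?thesis
      using Re by (simp add: side_def complex_eq_iff)
  next
    case 2
    have "Re z = of_int (int N * m) * mesh k" using Re column_top 2 by metis
    then have "z \<in> chord k n" by (rule chord_over_mesh_point[OF z(1)])
    moreover have "Im z = h (l + 1)" using curve Re curve_column(2)[of l m] 2 by simp
    ultimately show ?thesis
      using Re by (simp add: side_def complex_eq_iff)
  qed
qed

lemma sides_meet:
  assumes z: "z \<in> edge_arc (side k m)" "z \<in> edge_arc (side l n)" and ne: "side k m \<noteq> side l n"
  shows "z \<in> side k m \<and> z \<in> side l n"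
proof -
  have Re: "Re z = of_int m * \<sigma> k" "Re z = of_int n * \<sigma> l"
    and Im: "h k \<le> Im z" "Im z \<le> h (k + 1)" "h l \<le> Im z" "Im z \<le> h (l + 1)"
    using z unfolding edge_arc_side by auto
  have "h k \<le> h (l + 1)" "h l \<le> h (k + 1)" using Im by linarith+
  then have "k \<le> l + 1" "l \<le> k + 1" unfolding h_le_iff .
  moreover have "k \<noteq> l"
  proof
    assume "k = l"
    then have "m = n" using Re \<sigma>_pos[of l] by simp
    then show False using ne \<open>k = l\<close> by simp
  qed
  ultimately consider "l = k + 1" | "k = l + 1" by linarith
  then show ?thesis using Im Re unfolding side_def by cases (auto simp: complex_eq_iff)
qed

text \<open>For either parity of the position, the sides at multiples of \<open>\<sigma> k\<close> have both ends
  at nodes, and so meet other edges in common end points only.\<close>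

lemma plane_edges_all: "plane_edges (range (case_prod chord) \<union> range (case_prod side))"
proof -
  have "edge_arc e \<inter> edge_arc f \<subseteq> e \<inter> f"
    if "e \<in> range (case_prod chord) \<union> range (case_prod side)"
      "f \<in> range (case_prod chord) \<union> range (case_prod side)" "e \<noteq> f" for e f
    using that chords_meet chord_side_meet sides_meet by fast
  then show ?thesis unfolding plane_edges_def by blast
qed

lemma polygon_edges_brick_subset:
  "polygon_edges (brick k m) \<subseteq> range (case_prod chord) \<union> range (case_prod side)"
  unfolding polygon_edges_brick by auto

lemma simple_polygon_brick: "simple_polygon (brick k m)"
  unfolding simple_polygon_def
proof (intro conjI)
  show "3 \<le> length (brick k m)" using N_pos c_pos[of k] unfolding brick_def by (cases N) auto
  have inj: "inj_on (\<lambda>i. node l (p + int i)) S" for l p S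
    using mesh_pos[of l] by (auto simp: inj_on_def node_def)
  have "node k i \<noteq> node (k + 1) j" for i j
    using h_less_Suc[of k] by (auto simp: node_def)
  then show "distinct (brick k m)"
    unfolding brick_def by (auto simp: distinct_map inj simp del: upt_Suc)
  show "set (brick k m) \<subseteq> hplane" unfolding brick_def using node_in_hplane by auto
  show "plane_edges (polygon_edges (brick k m))"
    using plane_edges_subset[OF plane_edges_all polygon_edges_brick_subset] .
qed

section \<open>The tiling\<close>

text \<open>A horocycle \<open>h l\<close> below the point need not have its curve below it; in that case the curve of
  level \<open>l - 1\<close> is, because it stays below the horocycle \<open>h l\<close>.\<close>

lemma brick_at_point:
  assumes "z \<in> hplane"
  obtains k m where "even (m - k)" "of_int m * \<sigma> k \<le> Re z" "Re z < of_int (m + 2) * \<sigma> k"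
    "curve k (Re z) \<le> Im z" "Im z < curve (k + 1) (Re z)"
proof -
  obtain l where l: "h l \<le> Im z" "Im z < h (l + 1)" using exhaust assms by (auto simp: hplane_def)
  obtain k where k: "curve k (Re z) \<le> Im z" "Im z < curve (k + 1) (Re z)"
  proof (cases "curve l (Re z) \<le> Im z")
    case True
    then show ?thesis using that[of l] l h_le_curve[of "l + 1" "Re z"] by linarith
  next
    case False
    then show ?thesis using that[of "l - 1"] l curve_less[of "l - 1" "Re z"] by simp
  qed
  define u j where "u = Re z / \<sigma> k" and "j = \<lfloor>(u - of_int k) / 2\<rfloor>"
  have x: "Re z = u * \<sigma> k" using \<sigma>_pos[of k] unfolding u_def by simp
  have "of_int j \<le> (u - of_int k) / 2" "(u - of_int k) / 2 < of_int j + 1"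
    unfolding j_def by linarith+
  then have "of_int (k + 2 * j) \<le> u" "u < of_int (k + 2 * j + 2)" by simp_all
  then have "of_int (k + 2 * j) * \<sigma> k \<le> Re z" "Re z < of_int (k + 2 * j + 2) * \<sigma> k"
    unfolding x using \<sigma>_pos[of k] by (simp_all del: of_int_add of_int_mult)
  then show ?thesis using that[of "k + 2 * j" k] k by simp
qed

lemma brick_core_disjoint:
  assumes "even (m - k)" "even (n - l)" "(k, m) \<noteq> (l, n)"
  shows "brick_core k m \<inter> brick_core l n = {}"
proof -
  have levels: "brick_core k m \<inter> brick_core l n = {}" if "k < l" for k l m n
  proof -
    have "curve (k + 1) x \<le> curve l x" for x using that by (intro curve_le_curve) simp
    then show ?thesis unfolding strict_between_graphs_def
      by (auto simp: disjoint_iff) (meson less_le_not_le order.trans less_imp_le)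
  qed
  show ?thesis
  proof (cases k l rule: linorder_cases)
    case less then show ?thesis by (rule levels)
  next
    case greater then show ?thesis using levels[OF greater, of n m] by blast
  next
    case equal
    then have "m \<noteq> n" "even (m - n)" using assms by auto
    then have mn: "m + 2 \<le> n \<or> n + 2 \<le> m" by presburger
    have mono: "of_int i * \<sigma> k \<le> of_int j * \<sigma> k" if "i \<le> j" for i j
      using that \<sigma>_pos[of k] by simp
    show ?thesis using mn mono[of "m + 2" n] mono[of "n + 2" m]
      unfolding equal[symmetric] strict_between_graphs_def by (auto simp: disjoint_iff)
  qed
qed

text \<open>Bounds on the height leave finitely many strips, and bounds on the real part leave finitely
  many bricks in each of them.\<close>

lemma finite_brick_regions_meeting:
  assumes "0 < lo" and S: "\<And>w. w \<in> S \<Longrightarrow> lo \<le> Im w \<and> Im w \<le> hi \<and> \<bar>Re w\<bar> \<le> M"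
  shows "finite {p \<in> bricks. polygon_region p \<inter> S \<noteq> {}}"
proof (cases "S = {}")
  case False
  then have "0 < hi" using S \<open>0 < lo\<close> by force
  obtain k0 where k0: "h k0 \<le> lo" using exhaust[OF \<open>0 < lo\<close>] by blast
  obtain k1 where k1: "hi < h (k1 + 1)" using exhaust[OF \<open>0 < hi\<close>] by blast
  let ?I = "SIGMA k:{k0 - 2..k1 + 1}. {\<lfloor>- M / \<sigma> k\<rfloor> - 2..\<lceil>M / \<sigma> k\<rceil>}"
  have "{p \<in> bricks. polygon_region p \<inter> S \<noteq> {}} \<subseteq> (\<lambda>(k, m). brick k m) ` ?I"
  proof
    fix p assume "p \<in> {p \<in> bricks. polygon_region p \<inter> S \<noteq> {}}"
    then obtain k m w where p: "p = brick k m" "w \<in> brick_region k m" "w \<in> S"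
      unfolding bricks_def using polygon_region_brick by blast
    have w: "of_int m * \<sigma> k \<le> Re w" "Re w \<le> of_int (m + 2) * \<sigma> k"
      "curve k (Re w) \<le> Im w" "Im w \<le> curve (k + 1) (Re w)"
      using p(2) unfolding between_graphs_def by auto
    have b: "lo \<le> Im w" "Im w \<le> hi" "\<bar>Re w\<bar> \<le> M" using S[OF p(3)] by auto
    have "h k < h (k1 + 1)" "h k0 < h (k + 1 + 1)"
      using w(3,4) b(1,2) k0 k1 h_le_curve[of k "Re w"] curve_less[of "k + 1" "Re w"] by linarith+
    then have "k < k1 + 1" "k0 < k + 1 + 1" unfolding h_less_iff .
    moreover have "of_int m \<le> M / \<sigma> k" "- M / \<sigma> k \<le> of_int (m + 2)"
      using w(1,2) b(3) \<sigma>_pos[of k] by (simp_all add: field_simps)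
    then have "m \<le> \<lceil>M / \<sigma> k\<rceil>" "\<lfloor>- M / \<sigma> k\<rfloor> - 2 \<le> m" by linarith+
    ultimately show "p \<in> (\<lambda>(k, m). brick k m) ` ?I" unfolding p(1) by auto
  qed
  then show ?thesis by (rule finite_subset) auto
qed simp

theorem hyperbolic_tiling_bricks: "hyperbolic_tiling bricks"
  unfolding hyperbolic_tiling_def
proof (intro conjI ballI impI)
  show "simple_polygon p" if "p \<in> bricks" for p
    using that simple_polygon_brick unfolding bricks_def by blast
  show "plane_edges (\<Union> (polygon_edges ` bricks))"
    by (rule plane_edges_subset[OF plane_edges_all])
      (use polygon_edges_brick_subset in \<open>auto simp: bricks_def\<close>)
  show "\<Union> (polygon_region ` bricks) = hplane"
  proof
    show "\<Union> (polygon_region ` bricks) \<subseteq> hplane"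
      using curve_pos less_le_trans
      by (fastforce simp: bricks_def polygon_region_brick between_graphs_def hplane_def)
    show "hplane \<subseteq> \<Union> (polygon_region ` bricks)"
    proof
      fix z assume "z \<in> hplane"
      then obtain k m where *: "even (m - k)" "of_int m * \<sigma> k \<le> Re z" "Re z < of_int (m + 2) * \<sigma> k"
        "curve k (Re z) \<le> Im z" "Im z < curve (k + 1) (Re z)" by (rule brick_at_point)
      then have "z \<in> polygon_region (brick k m)"
        unfolding polygon_region_brick between_graphs_def by simp
      then show "z \<in> \<Union> (polygon_region ` bricks)" using *(1) unfolding bricks_def by blast
    qed
  qed
  show "interior (polygon_region p) \<inter> interior (polygon_region q) = {}"
    if "p \<in> bricks" "q \<in> bricks" "p \<noteq> q" for p q
  proof -
    obtain k m l n where pq: "p = brick k m" "q = brick l n" "even (m - k)" "even (n - l)"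
      using \<open>p \<in> bricks\<close> \<open>q \<in> bricks\<close> unfolding bricks_def by blast
    then have "brick_core k m \<inter> brick_core l n = {}"
      using \<open>p \<noteq> q\<close> by (intro brick_core_disjoint) auto
    then show ?thesis
      unfolding pq polygon_region_brick using interior_between_graphs by fast
  qed
  show "\<exists>\<epsilon>>0. finite {p \<in> bricks. polygon_region p \<inter> hdisk z \<epsilon> \<noteq> {}}" if z: "z \<in> hplane" for z
  proof (intro exI conjI)
    have y: "0 < Im z" using z by (simp add: hplane_def)
    define hi where "hi = exp 1 * Im z"
    show "finite {p \<in> bricks. polygon_region p \<inter> hdisk z 1 \<noteq> {}}"
    proof (rule finite_brick_regions_meeting)
      show "0 < Im z / exp 1" using y by simp
      fix w assume "w \<in> hdisk z 1"
      then have w: "w \<in> hplane" "hdist z w \<le> 1" "hdist w z \<le> 1"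
        by (auto simp: hdisk_def hdist_commute)
      have hi: "Im w \<le> hi" unfolding hi_def by (rule hdist_le_imp_Im_le[OF z w(1,2)])
      have lo: "Im z / exp 1 \<le> Im w"
        using hdist_le_imp_Im_le[OF w(1) z w(3)] by (simp add: field_simps)
      have "(Re z - Re w)\<^sup>2 \<le> 2 * Im z * Im w * (cosh 1 - 1)"
        by (rule hdist_le_imp_Re_diff[OF z w(1,2)])
      also have "\<dots> \<le> 2 * Im z * hi * (cosh 1 - 1)"
        using hi y cosh_real_ge_1[of 1] by (intro mult_right_mono mult_left_mono) auto
      finally have "\<bar>Re z - Re w\<bar> \<le> sqrt (2 * Im z * hi * (cosh 1 - 1))"
        by (metis real_sqrt_abs real_sqrt_le_iff)
      then have "\<bar>Re w\<bar> \<le> \<bar>Re z\<bar> + sqrt (2 * Im z * hi * (cosh 1 - 1))" by linarith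
      then show "Im z / exp 1 \<le> Im w \<and> Im w \<le> hi \<and>
          \<bar>Re w\<bar> \<le> \<bar>Re z\<bar> + sqrt (2 * Im z * hi * (cosh 1 - 1))"
        using lo hi by blast
    qed
  qed simp
qed

section \<open>Adjacency of bricks\<close>

text \<open>The positions \<open>m\<close> and \<open>n\<close> differ by less than 3, hence by 0 or 2 as they have equal parity.\<close>

lemma bricks_same_level:
  assumes m: "even (m - k)" "even (n - k)"
    and z: "of_int m * \<sigma> k \<le> Re z" "Re z < of_int (m + 2) * \<sigma> k"
    and w: "of_int n * \<sigma> k \<le> Re w" "Re w < of_int (n + 2) * \<sigma> k"
    and near: "\<bar>Re z - Re w\<bar> < \<sigma> k"
  shows "brick k m = brick k n \<or> adjacent_tiles (brick k m) (brick k n)"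
proof -
  have "of_int m * \<sigma> k < of_int (n + 2) * \<sigma> k + \<sigma> k" "of_int n * \<sigma> k < of_int (m + 2) * \<sigma> k + \<sigma> k"
    using z w near by linarith+
  then have "of_int m * \<sigma> k < of_int (n + 3) * \<sigma> k" "of_int n * \<sigma> k < of_int (m + 3) * \<sigma> k"
    by (simp_all add: algebra_simps)
  then have "m < n + 3" "n < m + 3" using \<sigma>_pos[of k] by (simp_all del: of_int_add)
  moreover have "even (m - n)" using m by presburger
  ultimately have "m = n \<or> m = n + 2 \<or> n = m + 2" by presburger
  then show ?thesis unfolding adjacent_tiles_def polygon_edges_brick by blast
qed

text \<open>In the unit \<open>\<sigma> k\<close>, the lower brick occupies \<open>[m, m + 2]\<close> and the upper one
  \<open>[C * n, C * (n + 2)]\<close>, where the ends of the latter have the parity opposite to \<open>m\<close>. So if the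
  intervals are at distance less than 1, they have a unit interval in common, and over it both
  bricks have the same \<open>N\<close> chords.\<close>

lemma bricks_next_level:
  assumes m: "even (m - k)" "even (n - (k + 1))"
    and z: "of_int m * \<sigma> k \<le> Re z" "Re z < of_int (m + 2) * \<sigma> k"
    and w: "of_int n * \<sigma> (k + 1) \<le> Re w" "Re w < of_int (n + 2) * \<sigma> (k + 1)"
    and near: "\<bar>Re z - Re w\<bar> < \<sigma> k"
  shows "adjacent_tiles (brick k m) (brick (k + 1) n)"
proof -
  define C where "C = int (c (k + 1))"
  have odd_C: "odd C" unfolding C_def using odd_c by simp
  have \<sigma>C: "of_int j * \<sigma> (k + 1) = of_int (C * j) * \<sigma> k" for j
    using \<sigma>_step[of "k + 1"] unfolding C_def by simp
  have "of_int m * \<sigma> k < of_int (C * (n + 2)) * \<sigma> k + \<sigma> k"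
    "of_int (C * n) * \<sigma> k < of_int (m + 2) * \<sigma> k + \<sigma> k"
    using z w near unfolding \<sigma>C by linarith+
  then have "of_int m * \<sigma> k < of_int (C * (n + 2) + 1) * \<sigma> k"
    "of_int (C * n) * \<sigma> k < of_int (m + 3) * \<sigma> k"
    by (simp_all add: algebra_simps)
  then have le: "m < C * (n + 2) + 1" "C * n < m + 3"
    using \<sigma>_pos[of k] by (simp_all del: of_int_add of_int_mult)
  have "odd (C * n - m)" "odd (C * (n + 2) - m)" using m odd_C by simp_all
  then have le': "m + 1 \<le> C * (n + 2)" "C * n \<le> m + 1" using le by presburger+
  have "C * n < C * (n + 2)" using odd_C unfolding C_def by (simp add: algebra_simps) presburger
  \<comment> \<open>\<open>[j, j + 1]\<close> is the common unit interval\<close>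
  obtain j where j: "m \<le> j" "j + 1 \<le> m + 2" "C * n \<le> j" "j + 1 \<le> C * (n + 2)"
  proof (cases "m + 1 < C * (n + 2)")
    case True then show ?thesis using that[of "m + 1"] le' by simp
  next
    case False then show ?thesis using that[of m] le' \<open>C * n < C * (n + 2)\<close> by simp
  qed
  have "int N * m \<le> int N * j" "int N * (C * n) \<le> int N * j"
    using j by (simp_all add: mult_left_mono)
  moreover have "int N * (j + 1) \<le> int N * (m + 2)" "int N * (j + 1) \<le> int N * (C * (n + 2))"
    using j by (intro mult_left_mono; simp)+
  moreover have "int N * (j + 1) > int N * j" using N_pos by (simp add: algebra_simps)
  moreover have C: "int (N * c (k + 1)) * i = int N * (C * i)" for i
    unfolding C_def by simp
  ultimately have "int N * j \<in> {int N * m..<int N * (m + 2)}"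
    "int N * j \<in> {int (N * c (k + 1)) * n..<int (N * c (k + 1)) * (n + 2)}"
    unfolding atLeastLessThan_iff C by linarith+
  then have "chord (k + 1) (int N * j) \<in> polygon_edges (brick k m) \<inter> polygon_edges (brick (k + 1) n)"
    unfolding polygon_edges_brick by blast
  moreover have "brick k m \<noteq> brick (k + 1) n"
  proof
    assume "brick k m = brick (k + 1) n"
    then have "hd (brick k m) = hd (brick (k + 1) n)" by simp
    then have "h k = h (k + 1)" unfolding brick_def by (simp add: node_def upt_rec)
    then show False using h_less_Suc[of k] by simp
  qed
  ultimately show ?thesis unfolding adjacent_tiles_def by blast
qed

end

section \<open>Dimensions of the bricks for a given radius\<close>

text \<open>The exponent of the least power of 3 that is at least \<open>exp (4 * r * k)\<close>.\<close>

definition exponent :: "real \<Rightarrow> int \<Rightarrow> int" where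
  "exponent r k = \<lceil>4 * r * of_int k / ln 3\<rceil>"

text \<open>In the unit \<open>level r k\<close>, a bound on the horizontal displacement between a point of the strip
  \<open>k\<close> and a point at distance at most \<open>2 * r\<close> from it; see \<open>near_points_Re\<close>.\<close>

definition reach :: "real \<Rightarrow> real" where
  "reach r = 2 * sinh r * exp (6 * r)"

definition level :: "real \<Rightarrow> int \<Rightarrow> real" where
  "level r k = exp (4 * r * of_int k)"

definition half_width :: "real \<Rightarrow> int \<Rightarrow> real" where
  "half_width r k = reach r * 3 powr of_int (exponent r k)"

text \<open>So many chords per half-width that the spacing of the nodes of level \<open>k\<close> is at most
  \<open>2 * r * level r k\<close>.\<close>

definition subdivision :: "real \<Rightarrow> nat" where
  "subdivision r = nat \<lceil>3 * reach r / (2 * r)\<rceil>"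

definition branching :: "real \<Rightarrow> int \<Rightarrow> nat" where
  "branching r k = 3 ^ nat (exponent r k - exponent r (k - 1))"

lemma reach_pos: "0 < r \<Longrightarrow> 0 < reach r"
  unfolding reach_def by simp

lemma half_width_bounds:
  assumes "0 < r"
  shows "reach r * level r k \<le> half_width r k" "half_width r k < 3 * reach r * level r k"
proof -
  have l3: "0 < ln (3::real)" by simp
  let ?e = "real_of_int (exponent r k)"
  have "4 * r * of_int k / ln 3 \<le> ?e" "?e < 4 * r * of_int k / ln 3 + 1"
    unfolding exponent_def by linarith+
  then have "4 * r * of_int k \<le> ?e * ln 3" "?e * ln 3 < ln 3 + 4 * r * of_int k"
    using l3 by (simp_all add: field_simps)
  then have "exp (4 * r * of_int k) \<le> exp (?e * ln 3)" "exp (?e * ln 3) < exp (ln 3 + 4 * r * of_int k)"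
    by simp_all
  then have "level r k \<le> 3 powr ?e" "3 powr ?e < 3 * level r k"
    unfolding level_def powr_def exp_add by simp_all
  then show "reach r * level r k \<le> half_width r k" "half_width r k < 3 * reach r * level r k"
    using reach_pos[OF assms] unfolding half_width_def by simp_all
qed

section \<open>Distances and coverings in the brick wall\<close>

locale fine_bricks =
  fixes r :: real
  assumes r_pos: "0 < r"
begin

lemma level_add: "level r (k + 1) = exp (4 * r) * level r k"
  unfolding level_def by (simp add: exp_add[symmetric] algebra_simps)

lemma subdivision_bound: "3 * reach r \<le> 2 * r * real (subdivision r)"
proof -
  have "3 * reach r / (2 * r) \<le> real (subdivision r)" unfolding subdivision_def by linarith
  then show ?thesis using r_pos by (simp add: field_simps)
qed

lemma subdivision_pos: "0 < subdivision r"
  using subdivision_bound reach_pos[OF r_pos] r_pos by (cases "subdivision r") auto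

text \<open>A chord of a horocycle of height \<open>h\<close> with ends at Euclidean distance at most \<open>2 * r * h\<close> rises
  at most to \<open>sqrt (1 + r\<^sup>2) * h\<close>, which is at most \<open>exp r * h\<close>.\<close>

lemma mesh_sq_bound:
  "(level r k)\<^sup>2 + (half_width r (k - 1) / subdivision r)\<^sup>2 / 4 \<le> (exp r * level r k)\<^sup>2"
proof -
  have pos: "0 < level r k" "0 < real (subdivision r)" using subdivision_pos by (simp_all add: level_def)
  have "half_width r (k - 1) < 3 * reach r * level r (k - 1)" by (rule half_width_bounds[OF r_pos])
  also have "\<dots> \<le> 3 * reach r * level r k"
    using reach_pos[OF r_pos] r_pos unfolding level_def by simp
  also have "\<dots> \<le> 2 * r * real (subdivision r) * level r k"
    using subdivision_bound pos by (intro mult_right_mono) auto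
  finally have "half_width r (k - 1) / subdivision r \<le> 2 * r * level r k"
    using pos by (simp add: field_simps)
  moreover have "0 \<le> half_width r (k - 1) / subdivision r"
    using reach_pos[OF r_pos] unfolding half_width_def by simp
  ultimately have "(half_width r (k - 1) / subdivision r)\<^sup>2 \<le> (2 * r * level r k)\<^sup>2"
    by (rule power_mono)
  then have "(level r k)\<^sup>2 + (half_width r (k - 1) / subdivision r)\<^sup>2 / 4 \<le> (1 + r\<^sup>2) * (level r k)\<^sup>2"
    by (simp add: power_mult_distrib algebra_simps)
  also have "\<dots> \<le> (exp r)\<^sup>2 * (level r k)\<^sup>2"
  proof (rule mult_right_mono)
    have "(1 + r)\<^sup>2 \<le> (exp r)\<^sup>2" using r_pos exp_ge_add_one_self by (intro power_mono) auto
    then show "1 + r\<^sup>2 \<le> (exp r)\<^sup>2" using r_pos by (simp add: power2_sum)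
  qed simp
  finally show ?thesis by (simp add: power_mult_distrib)
qed

sublocale horocyclic_bricks "level r" "half_width r" "subdivision r" "branching r"
proof
  fix k
  show "0 < level r k" by (simp add: level_def)
  show "0 < half_width r k" using reach_pos[OF r_pos] by (simp add: half_width_def)
  show "0 < subdivision r" by (rule subdivision_pos)
  have "exponent r (k - 1) \<le> exponent r k"
    unfolding exponent_def using r_pos by (intro ceiling_mono divide_right_mono mult_left_mono) auto
  then have "(3::real) powr of_int (exponent r k)
      = 3 ^ nat (exponent r k - exponent r (k - 1)) * 3 powr of_int (exponent r (k - 1))"
    by (simp add: powr_realpow[symmetric] powr_add[symmetric])
  then show "half_width r k = of_nat (branching r k) * half_width r (k - 1)"
    unfolding half_width_def branching_def by simp
  show "odd (branching r k)" unfolding branching_def by simp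
  have "exp r * level r k < level r (k + 1)"
    unfolding level_add using r_pos by (simp add: level_def)
  then have "(exp r * level r k)\<^sup>2 < (level r (k + 1))\<^sup>2"
    by (intro power_strict_mono) (auto simp: level_def)
  then show "(level r k)\<^sup>2 + (half_width r (k - 1) / subdivision r)\<^sup>2 / 4 < (level r (k + 1))\<^sup>2"
    using mesh_sq_bound[of k] by linarith
next
  fix y :: real assume y: "0 < y"
  define k where "k = \<lfloor>ln y / (4 * r)\<rfloor>"
  have "of_int k \<le> ln y / (4 * r)" "ln y / (4 * r) < of_int (k + 1)" unfolding k_def by linarith+
  then have "4 * r * of_int k \<le> ln y" "ln y < 4 * r * of_int (k + 1)"
    using r_pos by (simp_all add: field_simps)
  then have "level r k \<le> y \<and> y < level r (k + 1)"
    unfolding level_def using y by (metis exp_le_cancel_iff exp_less_cancel_iff exp_ln)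
  then show "\<exists>k. level r k \<le> y \<and> y < level r (k + 1)" ..
qed

lemma curve_le: "curve k x \<le> exp r * level r k"
proof (rule power2_le_imp_le)
  show "(curve k x)\<^sup>2 \<le> (exp r * level r k)\<^sup>2"
    using curve_sq_le[of k x] mesh_sq_bound[of k] unfolding mesh_def by linarith
qed (simp add: level_def)

text \<open>The height of \<open>z\<close> is less than \<open>exp r * level r (k + 1) = exp (5 * r) * level r k\<close>. The other point
  is higher by at most the factor \<open>exp (2 * r)\<close>, which contributes its square root \<open>exp r\<close> to the
  bound \<open>2 * sinh r * sqrt (Im z * Im w)\<close> for the horizontal displacement.\<close>

lemma near_points_Re:
  assumes z: "z \<in> hplane" "w \<in> hplane" "hdist z w \<le> 2 * r" and "Im z < curve (k + 1) (Re z)"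
  shows "\<bar>Re z - Re w\<bar> < half_width r k"
proof -
  have y: "0 < Im z" "0 < Im w" using z by (auto simp: hplane_def)
  have Imw: "Im w \<le> exp (2 * r) * Im z" by (rule hdist_le_imp_Im_le[OF z])
  have "(Re z - Re w)\<^sup>2 \<le> 2 * Im z * Im w * (cosh (2 * r) - 1)"
    by (rule hdist_le_imp_Re_diff[OF z])
  also have "cosh (2 * r) - 1 = 2 * (sinh r)\<^sup>2"
    using cosh_double[of r] cosh_square_eq[of r] by simp
  also have "2 * Im z * Im w * (2 * (sinh r)\<^sup>2) \<le> 2 * Im z * (exp (2 * r) * Im z) * (2 * (sinh r)\<^sup>2)"
    using y Imw by (intro mult_right_mono mult_left_mono) auto
  also have "\<dots> = (2 * sinh r * exp r * Im z)\<^sup>2"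
    by (simp add: power2_eq_square exp_add[symmetric])
  finally have "\<bar>Re z - Re w\<bar> \<le> 2 * sinh r * exp r * Im z"
    using y r_pos abs_le_square_iff[of "Re z - Re w" "2 * sinh r * exp r * Im z"] by simp
  also have "\<dots> < 2 * sinh r * exp r * (exp r * (exp (4 * r) * level r k))"
    using assms(4) curve_le[of "k + 1" "Re z"] r_pos unfolding level_add by simp
  also have "\<dots> = reach r * level r k"
    unfolding reach_def by (simp add: exp_add[symmetric])
  also have "\<dots> \<le> half_width r k" by (rule half_width_bounds[OF r_pos])
  finally show ?thesis .
qed

text \<open>Between the upper curve of strip \<open>k\<close> and the horocycle at the bottom of strip \<open>k + 2\<close> there is
  a gap of logarithmic height at least \<open>4 * r - r\<close>, whereas \<open>w\<close> is higher than \<open>z\<close> by at most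
  \<open>2 * r\<close> on the logarithmic scale.\<close>

lemma near_points_level:
  assumes z: "z \<in> hplane" "w \<in> hplane" "hdist z w \<le> 2 * r"
    and "Im z < curve (k + 1) (Re z)" "curve l (Re w) \<le> Im w"
  shows "l \<le> k + 1"
proof -
  have "level r l \<le> Im w" using assms(5) h_le_curve[of l "Re w"] by linarith
  also have "\<dots> \<le> exp (2 * r) * Im z" by (rule hdist_le_imp_Im_le[OF z])
  also have "\<dots> < exp (2 * r) * (exp r * level r (k + 1))"
    using assms(4) curve_le[of "k + 1" "Re z"] by simp
  also have "\<dots> = exp (3 * r) * level r (k + 1)"
    by (simp add: exp_add[symmetric])
  also have "\<dots> < level r (k + 1 + 1)"
    unfolding level_add[of "k + 1"] using r_pos by (simp add: level_def)
  finally show ?thesis unfolding h_less_iff by simp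
qed

theorem near_points_in_adjacent_bricks:
  assumes "z \<in> hplane" "w \<in> hplane" "hdist z w \<le> 2 * r"
  shows "\<exists>p\<in>bricks. \<exists>q\<in>bricks. z \<in> polygon_region p \<and> w \<in> polygon_region q \<and>
    (p = q \<or> adjacent_tiles p q)"
proof -
  obtain k m where z: "even (m - k)" "of_int m * half_width r k \<le> Re z"
    "Re z < of_int (m + 2) * half_width r k" "curve k (Re z) \<le> Im z" "Im z < curve (k + 1) (Re z)"
    using brick_at_point[OF assms(1)] .
  obtain l n where w: "even (n - l)" "of_int n * half_width r l \<le> Re w"
    "Re w < of_int (n + 2) * half_width r l" "curve l (Re w) \<le> Im w" "Im w < curve (l + 1) (Re w)"
    using brick_at_point[OF assms(2)] .
  have wz: "hdist w z \<le> 2 * r" using assms(3) by (simp add: hdist_commute)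
  have sym: "adjacent_tiles p q" if "adjacent_tiles q p" for p q
    using that unfolding adjacent_tiles_def by blast
  note dz = near_points_Re[OF assms z(5)] and dw = near_points_Re[OF assms(2,1) wz w(5)]
  have "l \<le> k + 1" "k \<le> l + 1"
    using near_points_level[OF assms z(5) w(4)] near_points_level[OF assms(2,1) wz w(5) z(4)] .
  then consider "l = k" | "l = k + 1" | "k = l + 1" by linarith
  then have "brick k m = brick l n \<or> adjacent_tiles (brick k m) (brick l n)"
  proof cases
    case 1
    then show ?thesis using bricks_same_level[OF z(1) _ z(2,3) _ _ dz] w by simp
  next
    case 2
    then show ?thesis using bricks_next_level[OF z(1) _ z(2,3) _ _ dz] w by simp
  next
    case 3
    then show ?thesis using bricks_next_level[OF w(1) _ w(2,3) _ _ dw] z sym by simp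
  qed
  moreover have "brick k m \<in> bricks" "brick l n \<in> bricks"
    using z(1) w(1) unfolding bricks_def by blast+
  moreover have "z \<in> polygon_region (brick k m)" "w \<in> polygon_region (brick l n)"
    unfolding polygon_region_brick between_graphs_def using z w by simp_all
  ultimately show ?thesis by blast
qed

text \<open>The upper curve of the strip \<open>k\<close> stays below \<open>level r (k + 2) = exp (8 * r) * level r k\<close>, so 8
  rows suffice. As \<open>reach r / sinh (r/2)\<close> stays bounded when \<open>r\<close> tends to 0, the number of columns
  is bounded for small radii.\<close>

theorem brick_covered_by_disks:
  assumes "p \<in> bricks"
  shows "\<exists>D. finite D \<and> D \<subseteq> hplane \<and> real (card D) \<le> 104 * 3 powr (8 * r) \<and>
    polygon_region p \<subseteq> (\<Union>c\<in>D. hdisk c r)"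
proof -
  obtain k m where p: "p = brick k m" using assms unfolding bricks_def by blast
  let ?a = "of_int m * half_width r k" and ?b = "of_int (m + 2) * half_width r k"
  have "?a \<le> ?b" using \<sigma>_pos[of k] by simp
  then obtain D where D: "finite D" "D \<subseteq> hplane"
    "real (card D) \<le> real 8 * ((?b - ?a) / (2 * level r k * sinh (r/2)) + 1)"
    "{z. ?a \<le> Re z \<and> Re z \<le> ?b \<and> level r k \<le> Im z \<and> Im z < level r k * exp (real 8 * r)}
      \<subseteq> (\<Union>c\<in>D. hdisk c r)"
    by (rule rectangle_cover[OF r_pos h_pos])
  have s: "0 < sinh (r/2)" using r_pos by simp
  have h: "0 < level r k" by (rule h_pos)
  have "polygon_region p \<subseteq>
    {z. ?a \<le> Re z \<and> Re z \<le> ?b \<and> level r k \<le> Im z \<and> Im z < level r k * exp (real 8 * r)}"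
  proof
    fix z assume "z \<in> polygon_region p"
    then have z: "?a \<le> Re z" "Re z \<le> ?b" "curve k (Re z) \<le> Im z" "Im z \<le> curve (k + 1) (Re z)"
      unfolding p polygon_region_brick between_graphs_def by auto
    have "level r (k + 1 + 1) = level r k * exp (real 8 * r)"
      unfolding level_def by (simp add: exp_add[symmetric] algebra_simps)
    then show "z \<in> {z. ?a \<le> Re z \<and> Re z \<le> ?b \<and> level r k \<le> Im z \<and>
        Im z < level r k * exp (real 8 * r)}"
      using z h_le_curve[of k "Re z"] curve_less[of "k + 1" "Re z"] by simp
  qed
  moreover have "real (card D) \<le> 104 * 3 powr (8 * r)"
  proof -
    have "(?b - ?a) / (2 * level r k * sinh (r/2)) = half_width r k / (level r k * sinh (r/2))"
      by (simp add: algebra_simps)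
    also have "\<dots> \<le> (3 * reach r * level r k) / (level r k * sinh (r/2))"
      using half_width_bounds(2)[OF r_pos, of k] s h by (intro divide_right_mono) auto
    also have "\<dots> = 12 * cosh (r/2) * exp (6 * r)"
      using s h sinh_double[of "r/2"] unfolding reach_def by (simp add: field_simps)
    also have "\<dots> \<le> 12 * exp (2 * r) * exp (6 * r)"
    proof -
      have "cosh (r/2) \<le> exp (r/2)"
        using r_pos unfolding cosh_def by (simp add: field_simps)
      also have "\<dots> \<le> exp (2 * r)" using r_pos by simp
      finally show ?thesis by simp
    qed
    also have "\<dots> = 12 * exp (8 * r)" by (simp add: exp_add[symmetric])
    finally have columns: "(?b - ?a) / (2 * level r k * sinh (r/2)) \<le> 12 * exp (8 * r)" .
    have "real (card D) \<le> 8 * (12 * exp (8 * r) + 1)"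
      by (rule order_trans[OF D(3)[unfolded of_nat_numeral]])
        (intro mult_left_mono add_right_mono columns, simp)
    also have "\<dots> \<le> 104 * exp (8 * r)" using r_pos by simp
    also have "exp (8 * r) \<le> 3 powr (8 * r)"
    proof -
      have "exp 1 \<le> (3::real)" by (rule exp_le)
      then have "1 \<le> ln (3::real)" by (metis exp_gt_zero ln_exp ln_mono zero_less_numeral)
      then show ?thesis using r_pos unfolding powr_def by (simp add: mult_left_le)
    qed
    finally show ?thesis by simp
  qed
  ultimately show ?thesis using D by blast
qed

end

theorem theorem3:
  "\<exists>C::real. \<forall>r::real. r > 0 \<longrightarrow>
     (\<exists>T. hyperbolic_tiling T \<and>
        (\<forall>p\<in>T. \<exists>D. finite D \<and> D \<subseteq> hplane \<and> real (card D) \<le> C * 3 powr (8 * r) \<and>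
           polygon_region p \<subseteq> (\<Union>c\<in>D. hdisk c r)) \<and>
        (\<forall>x\<in>hplane. \<forall>y\<in>hplane. hdist x y \<le> 2 * r \<longrightarrow>
           (\<exists>p\<in>T. \<exists>q\<in>T. x \<in> polygon_region p \<and> y \<in> polygon_region q \<and>
              (p = q \<or> adjacent_tiles p q))))"
proof (intro exI[of _ 104] allI impI)
  fix r :: real assume "0 < r"
  then interpret fine_bricks r by unfold_locales
  show "\<exists>T. hyperbolic_tiling T \<and>
        (\<forall>p\<in>T. \<exists>D. finite D \<and> D \<subseteq> hplane \<and> real (card D) \<le> 104 * 3 powr (8 * r) \<and>
           polygon_region p \<subseteq> (\<Union>c\<in>D. hdisk c r)) \<and>
        (\<forall>x\<in>hplane. \<forall>y\<in>hplane. hdist x y \<le> 2 * r \<longrightarrow>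
           (\<exists>p\<in>T. \<exists>q\<in>T. x \<in> polygon_region p \<and> y \<in> polygon_region q \<and>
              (p = q \<or> adjacent_tiles p q)))"
    using hyperbolic_tiling_bricks brick_covered_by_disks near_points_in_adjacent_bricks
    by (intro exI[of _ bricks] conjI ballI impI) auto
qed

end
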